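(* Let $\{x_k\}_{k\ge 0}$ be the infinite sequence generated by the algorithm $\mathrm{SSARC_qK}$ (described in the context) applied to the problem of minimizing $f(x)$ over $x\in\mathbb R^n$ subject to $c(x)=0$. Assume: (A1) $f$ is uniformly bounded from below, and $g=\nabla f$ and $c$ are uniformly bounded; (A2) $g$, $c$ and $\nabla c_i$ ($i=1,\dots,p$) are Lipschitz continuous in some open set $\mathcal C\supseteq\{x_k\}$; (A3) there is a constant $\kappa_{\rm B}\ge 0$ with $\|B_k\|\le\kappa_{\rm B}$ for all $k$; (A4) there is a constant $\kappa_{\rm n}>0$ with $\|v_k^c\|\le\kappa_{\rm n}\|c(x_k)\|$ for all $k$. Then $$\lim_{k\to\infty}c(x_k)=0.$$
   Context: Problem and notation. $f:\mathbb R^n\to\mathbb R$ and $c:\mathbb R^n\to\mathbb R^p$, $p\le n$, are sufficiently smooth; $g=\nabla f$; $J(x)$ is the $p\times n$ Jacobian of $c$; $\|\cdot\|$ is the Euclidean (and induced matrix) norm. Write $g_k=g(x_k)$, $c_k=c(x_k)$, $J_k=J(x_k)$. $B_k$ is the Hessian in $x$ of the Lagrangian $f(x)-s^Tc(x)$ at $(x_k,s_k)$, or a symmetric approximation of it. $J_k$ is assumed to have full row rank for all $k$. The columns of $Z_k$ form an orthonormal basis of the null space of $J_k$. A KKT (first-order critical) point is a point $x$ with $c(x)=0$ and $g(x)\in\operatorname{range}J(x)^T$. Parameters. $0<\eta_1<\eta_2<1$, $0<\gamma_1<1<\gamma_2$, $\nu\in(0,1)$, $\tau_1>1$, $\tau_2>0$,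 $\theta\in(0,1]$, $\xi>0$, $\zeta\in(0,1]$, $t\ge1$, positive integers $e_L,e_U$, and the shifts $\lambda_{(0)}=10^{-e_L/2}$, $\lambda_{(i+1)}=10^{1/2}\lambda_{(i)}$, $i=0,\dots,m$ with $m=e_L+e_U$, satisfying $10^{-e_L}\le\lambda_{(i)}\le10^{e_U}$. Start: $x_0\in\mathbb R^n$, $\beta_0>0$, $\mu_{-1}>0$, $k=0$. Shifted CG-Lanczos, for data $(B,b)$ ($B$ symmetric) and shift $\lambda$: set $w_0=0$, $a_0\upsilon_0=-b$ with $a_0>0$, $\|\upsilon_0\|=1$, $p_0=-b$, $\upsilon_{-1}=0$, $\sigma_0=a_0$, $\omega_{-1}=0$, $\pi_{-1}=1$. For $l=0,1,\dots$, while $\|b+(B+\lambda I)w_l\|>\xi\min\{\|b\|,\|w_l\|\}^{1+\zeta}$: $\delta_l=\upsilon_l^TB\upsilon_l$; $a_{l+1}\upsilon_{l+1}=B\upsilon_l-\delta_l\upsilon_l-a_l\upsilon_{l-1}$ with $a_{l+1}>0$, $\|\upsilon_{l+1}\|=1$; $\delta_l\leftarrow\delta_l+\lambda$; $\pi_l=1/(\delta_l-\omega_{l-1}/\pi_{l-1})$; break (negative curvature) if $\pi_l<0$; $\omega_l=(a_{l+1}\pi_l)^2$; $\sigma_{l+1}=-a_{l+1}\pi_l\sigma_l$; $w_{l+1}=w_l+\pi_lp_l$; $p_{l+1}=\sigma_{l+1}\upsilon_{l+1}+\omega_lp_l$. Output $u(\lambda)$: the final $w_l$. Functions. $\phi(x,\mu)=f(x)+\mu\|c(x)\|$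 and $q(x,B,\mu,d)=f(x)+g(x)^Td+\frac12d^TBd+\mu\|c(x)+J(x)d\|$. Algorithm $\mathrm{SSARC_qK}$. While $x_k$ is not a KKT point, do the following (outer iteration $k$). (1) Vertical step, computed once per outer iteration: $v_k^c=-J_k^T(J_kJ_k^T)^{-1}c_k$, $v_k=\alpha_kv_k^c$ with $\alpha_k\in\left[\min\{1,\theta\sqrt{\beta_k}/\|v_k^c\|\},\ \min\{1,\sqrt{\beta_k}/\|v_k^c\|\}\right]$ (so $v_k=0$ if $c_k=0$). (2) With $g_k^Z=Z_k^T(g_k+B_kv_k)$ and $B_k^Z=Z_k^TB_kZ_k$, compute, once per outer iteration, $u(\lambda_{(i)})$ for all shifts by shifted CG-Lanczos with data $(B_k^Z,g_k^Z)$ (approximate solution of $(B_k^Z+\lambda_{(i)}I)u=-g_k^Z$), and set $d(\lambda_{(i)})=v_k+Z_ku(\lambda_{(i)})$. (3) Let $i^+=\min\{0\le i\le m: B_k^Z+\lambda_{(i)}I\succ0\}$ (the smallest shift for which no negative curvature is detected) and let $j$ minimize $\left|\beta_k\lambda_{(i)}-\|u(\lambda_{(i)})\|\right|$ over $i^+\le i\le m$. (4) Inner loop, repeated until a trial step is accepted: (4a) Set $\lambda_k=\lambda_{(j)}$, $u_k=u(\lambda_{(j)})$, $h_k=Z_ku_k$ (horizontal step), $d_k=d(\lambda_{(j)})=v_k+h_k$. (4b) Put $\Delta q_k^N=\|c_k\|-\|c_k+J_kv_k\|$, $\Delta q_k^H=-(g_k+B_kv_k)^Th_k-\frac12h_k^TB_kh_k$,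 $\Delta q_k^F=-g_k^Tv_k-\frac12v_k^TB_kv_k$ and $\mu_k^c=-\dfrac{\Delta q_k^F+\Delta q_k^H}{(1-\nu)\Delta q_k^N}$; set $\mu_k=\max\{\mu_k^c,\tau_1\mu_{k-1},\mu_{k-1}+\tau_2\}$ if $\mu_{k-1}<\mu_k^c$, and $\mu_k=\mu_{k-1}$ otherwise (also if $\Delta q_k^N=0$). This enforces $\Delta q_k:=q(x_k,B_k,\mu_k,0)-q(x_k,B_k,\mu_k,d_k)=\Delta q_k^H+\mu_k\Delta q_k^N+\Delta q_k^F\ge\nu\mu_k\Delta q_k^N$. (4c) Compute $\rho_k=\dfrac{\phi(x_k,\mu_k)-\phi(x_k+d_k,\mu_k)}{\Delta q_k}$. (4d) If $\rho_k<\eta_1$ (trial rejected): set $\beta_{k+1}=\beta_k$, and while $\beta_{k+1}>\gamma_1\beta_k$ set $\beta_{k+1}=\|u(\lambda_{(j+1)})\|/\lambda_{(j+1)}$ and $j\leftarrow j+1$ (the sample of shifts is supposed to contain large enough values for this search to succeed); then return to (4a) with the new $j$. Neither $v_k$ nor any $u(\lambda_{(i)})$ is recomputed, and $k$ is not advanced. (4e) If $\rho_k\ge\eta_1$ (trial accepted): set $x_{k+1}=x_k+d_k$, update $B_{k+1}$, set $\beta_{k+1}=\gamma_2\beta_k$ if $\rho_k>\eta_2$ and $\beta_{k+1}=\beta_k$ otherwise, and leave the inner loop. (5) $k\leftarrow k+1$. Standing assumptions. The algorithm does not stop at a KKT point, so the sequence is infinite. For all $k$, with residual $r_k:=g_k^Z+(B_k^Z+\lambda_kI)u_k$,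 the pair $(\lambda_k,u_k)$ used at iteration $k$ satisfies $u_k^T(B_k^Z+\lambda_kI)u_k\ge0$, $\frac1t\frac{\|u_k\|}{\beta_k}\le\lambda_k\le t\frac{\|u_k\|}{\beta_k}$ and $\|r_k\|\le\xi\min\{\|g_k^Z\|,\|u_k\|\}^{1+\zeta}$; and $\beta_k\le\beta_{\max}$ for all $k\ge 0$ and some constant $\beta_{\max}>0$. *)

theory Defs
  imports "HOL-Analysis.Analysis"
begin

subsection \<open>The problem and the parameters\<close>

text \<open>Minimize \<open>obj x\<close> subject to \<open>con x = 0\<close>.\<close>

record ('n::finite, 'p::finite) nlp =
  obj :: "real^'n \<Rightarrow> real"
  grad :: "real^'n \<Rightarrow> real^'n"
  con :: "real^'n \<Rightarrow> real^'p"
  jac :: "real^'n \<Rightarrow> real^'n^'p"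

definition smooth_nlp :: "('n::finite, 'p::finite) nlp \<Rightarrow> bool" where
  "smooth_nlp Q \<longleftrightarrow>
     (\<forall>x. GDERIV (obj Q) x :> grad Q x) \<and>
     (\<forall>x. (con Q has_derivative (\<lambda>h. jac Q x *v h)) (at x)) \<and>
     continuous_on UNIV (grad Q) \<and> continuous_on UNIV (jac Q)"

definition kkt_point :: "('n::finite, 'p::finite) nlp \<Rightarrow> real^'n \<Rightarrow> bool" where
  "kkt_point Q x \<longleftrightarrow> con Q x = 0 \<and> grad Q x \<in> range (\<lambda>s. transpose (jac Q x) *v s)"

record ssarc_params =
  eta1 :: real
  eta2 :: real
  gamma1 :: real
  gamma2 :: real
  nu :: real
  tau1 :: real
  tau2 :: real
  theta :: real
  xi :: real
  zeta :: real
  eL :: nat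
  eU :: nat

definition valid_params :: "ssarc_params \<Rightarrow> bool" where
  "valid_params P \<longleftrightarrow>
     0 < eta1 P \<and> eta1 P < eta2 P \<and> eta2 P < 1 \<and>
     0 < gamma1 P \<and> gamma1 P < 1 \<and> 1 < gamma2 P \<and>
     0 < nu P \<and> nu P < 1 \<and> 1 < tau1 P \<and> 0 < tau2 P \<and>
     0 < theta P \<and> theta P \<le> 1 \<and> 0 < xi P \<and> 0 < zeta P \<and> zeta P \<le> 1 \<and>
     0 < eL P \<and> 0 < eU P"

primrec shift :: "ssarc_params \<Rightarrow> nat \<Rightarrow> real" where
  "shift P 0 = 10 powr (- real (eL P) / 2)"
| "shift P (Suc i) = 10 powr (1 / 2) * shift P i"

definition last_shift :: "ssarc_params \<Rightarrow> nat" where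
  "last_shift P = eL P + eU P"


subsection \<open>Shifted CG-Lanczos\<close>

text \<open>\<open>lanczos B b l\<close> is \<open>(\<upsilon>\<^sub>l, \<upsilon>\<^sub>l\<^sub>-\<^sub>1, a\<^sub>l)\<close>. If the right-hand side of the three-term
  recurrence vanishes, then \<open>a\<^sub>l\<^sub>+\<^sub>1 = 0\<close> and \<open>\<upsilon>\<^sub>l\<^sub>+\<^sub>1 = 0\<close>; the iterate
  \<open>w\<^sub>l\<^sub>+\<^sub>1\<close> does not depend on them.\<close>

primrec lanczos :: "real^'z::finite^'z \<Rightarrow> real^'z \<Rightarrow> nat \<Rightarrow> (real^'z) \<times> (real^'z) \<times> real" where
  "lanczos B b 0 = (- b /\<^sub>R norm b, 0, norm b)"
| "lanczos B b (Suc l) =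
     (let (y, y', a) = lanczos B b l;
          s = B *v y - (y \<bullet> (B *v y)) *\<^sub>R y - a *\<^sub>R y'
      in (s /\<^sub>R norm s, y, norm s))"

definition lanczos_vec :: "real^'z::finite^'z \<Rightarrow> real^'z \<Rightarrow> nat \<Rightarrow> real^'z" where
  "lanczos_vec B b l = fst (lanczos B b l)"

definition lanczos_coeff :: "real^'z::finite^'z \<Rightarrow> real^'z \<Rightarrow> nat \<Rightarrow> real" where
  "lanczos_coeff B b l = snd (snd (lanczos B b l))"

text \<open>\<open>cg_state B b \<lambda> l\<close> is \<open>(w\<^sub>l, p\<^sub>l, \<sigma>\<^sub>l, \<omega>\<^sub>l\<^sub>-\<^sub>1, \<pi>\<^sub>l\<^sub>-\<^sub>1)\<close>.\<close>

primrec cg_state ::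
  "real^'z::finite^'z \<Rightarrow> real^'z \<Rightarrow> real \<Rightarrow> nat \<Rightarrow> (real^'z) \<times> (real^'z) \<times> real \<times> real \<times> real"
where
  "cg_state B b lam 0 = (0, - b, norm b, 0, 1)"
| "cg_state B b lam (Suc l) =
     (let (w, p, \<sigma>, \<omega>', \<pi>') = cg_state B b lam l;
          y = lanczos_vec B b l;
          \<delta> = y \<bullet> (B *v y) + lam;
          \<pi> = 1 / (\<delta> - \<omega>' / \<pi>');
          a = lanczos_coeff B b (Suc l);
          \<omega> = (a * \<pi>)\<^sup>2;
          \<sigma>1 = - a * \<pi> * \<sigma>
      in (w + \<pi> *\<^sub>R p, \<sigma>1 *\<^sub>R lanczos_vec B b (Suc l) + \<omega> *\<^sub>R p, \<sigma>1, \<omega>, \<pi>))"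

definition cg_iterate :: "real^'z::finite^'z \<Rightarrow> real^'z \<Rightarrow> real \<Rightarrow> nat \<Rightarrow> real^'z" where
  "cg_iterate B b lam l = fst (cg_state B b lam l)"

definition cg_pi :: "real^'z::finite^'z \<Rightarrow> real^'z \<Rightarrow> real \<Rightarrow> nat \<Rightarrow> real" where
  "cg_pi B b lam l = snd (snd (snd (snd (cg_state B b lam (Suc l)))))"

text \<open>A pivot \<open>\<delta> - \<omega>' / \<pi>'\<close> equal to zero, for which \<open>\<pi>\<^sub>l\<close> is not defined mathematically,
  gives \<open>\<pi>\<^sub>l = 0\<close> here; it is treated like negative curvature, whence \<open>\<le>\<close> below. It cannot
  occur for a shift making the matrix positive definite, and no other shift is ever used.\<close>

definition cg_stops ::
  "ssarc_params \<Rightarrow> real^'z::finite^'z \<Rightarrow> real^'z \<Rightarrow> real \<Rightarrow> nat \<Rightarrow> bool" where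
  "cg_stops P B b lam l \<longleftrightarrow>
     (let w = cg_iterate B b lam l in
        norm (b + (B + lam *\<^sub>R mat 1) *v w) \<le> xi P * (min (norm b) (norm w)) powr (1 + zeta P)
        \<or> cg_pi B b lam l \<le> 0)"

definition cg_lanczos :: "ssarc_params \<Rightarrow> real^'z::finite^'z \<Rightarrow> real^'z \<Rightarrow> real \<Rightarrow> real^'z" where
  "cg_lanczos P B b lam = cg_iterate B b lam (LEAST l. cg_stops P B b lam l)"


subsection \<open>One outer iteration\<close>

text \<open>\<open>pt\<close> is \<open>x\<^sub>k\<close>, \<open>reg\<close> is \<open>\<beta>\<^sub>k\<close>, \<open>mu_prev\<close> is \<open>\<mu>\<^sub>k\<^sub>-\<^sub>1\<close>, \<open>hess\<close> is \<open>B\<^sub>k\<close>,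
  \<open>nullb\<close> is \<open>Z\<^sub>k\<close> and \<open>vert\<close> is \<open>v\<^sub>k\<close>, all at the start of the inner loop.\<close>

record ('n::finite, 'z::finite) ssarc_state =
  pt :: "real^'n"
  reg :: real
  mu_prev :: real
  hess :: "real^'n^'n"
  nullb :: "real^'z^'n"
  vert :: "real^'n"

text \<open>The columns of \<open>Z\<close> form an orthonormal basis of the null space of \<open>A\<close>, except that zero
  columns may be added. They are needed only for a trivial null space, as the type \<open>'z\<close>
  has at least one element; if \<open>CARD('z)\<close> is the dimension of the null space,
  then no column can be zero.\<close>

definition nullspace_basis :: "real^'n::finite^'p::finite \<Rightarrow> real^'z::finite^'n \<Rightarrow> bool" where
  "nullspace_basis A Z \<longleftrightarrow>
     (\<forall>i. column i Z = 0 \<or> norm (column i Z) = 1) \<and>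
     (\<forall>i i'. i \<noteq> i' \<longrightarrow> orthogonal (column i Z) (column i' Z)) \<and>
     span (columns Z) = {d. A *v d = 0}"

definition positive_definite :: "real^'z::finite^'z \<Rightarrow> bool" where
  "positive_definite A \<longleftrightarrow> transpose A = A \<and> (\<forall>u. u \<noteq> 0 \<longrightarrow> u \<bullet> (A *v u) > 0)"

definition cauchy_vert :: "('n::finite, 'p::finite) nlp \<Rightarrow> real^'n \<Rightarrow> real^'n" where
  "cauchy_vert Q x =
     - (transpose (jac Q x) *v (matrix_inv (jac Q x ** transpose (jac Q x)) *v con Q x))"

text \<open>For \<open>cauchy_vert Q x = 0\<close> the interval for \<open>\<alpha>\<close> is meaningless, but \<open>v = 0\<close> anyway.\<close>

definition vertical_step ::
  "ssarc_params \<Rightarrow> ('n::finite, 'p::finite) nlp \<Rightarrow> real^'n \<Rightarrow> real \<Rightarrow> real^'n \<Rightarrow> bool" where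
  "vertical_step P Q x \<beta> v \<longleftrightarrow>
     (let vc = cauchy_vert Q x in
      \<exists>\<alpha>. v = \<alpha> *\<^sub>R vc \<and>
          (vc \<noteq> 0 \<longrightarrow> \<alpha> \<in> {min 1 (theta P * sqrt \<beta> / norm vc) .. min 1 (sqrt \<beta> / norm vc)}))"

definition red_grad ::
  "('n::finite, 'p::finite) nlp \<Rightarrow> ('n, 'z::finite) ssarc_state \<Rightarrow> real^'z" where
  "red_grad Q s = transpose (nullb s) *v (grad Q (pt s) + hess s *v vert s)"

definition red_hess :: "('n::finite, 'z::finite) ssarc_state \<Rightarrow> real^'z^'z" where
  "red_hess s = transpose (nullb s) ** hess s ** nullb s"

definition u_step ::
  "ssarc_params \<Rightarrow> ('n::finite, 'p::finite) nlp \<Rightarrow> ('n, 'z::finite) ssarc_state \<Rightarrow> nat \<Rightarrow> real^'z"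
where
  "u_step P Q s i = cg_lanczos P (red_hess s) (red_grad Q s) (shift P i)"

definition h_step ::
  "ssarc_params \<Rightarrow> ('n::finite, 'p::finite) nlp \<Rightarrow> ('n, 'z::finite) ssarc_state \<Rightarrow> nat \<Rightarrow> real^'n"
where
  "h_step P Q s i = nullb s *v u_step P Q s i"

definition d_step ::
  "ssarc_params \<Rightarrow> ('n::finite, 'p::finite) nlp \<Rightarrow> ('n, 'z::finite) ssarc_state \<Rightarrow> nat \<Rightarrow> real^'n"
where
  "d_step P Q s i = vert s + h_step P Q s i"

definition merit :: "('n::finite, 'p::finite) nlp \<Rightarrow> real^'n \<Rightarrow> real \<Rightarrow> real" where
  "merit Q x \<mu> = obj Q x + \<mu> * norm (con Q x)"

definition model ::
  "('n::finite, 'p::finite) nlp \<Rightarrow> real^'n \<Rightarrow> real^'n^'n \<Rightarrow> real \<Rightarrow> real^'n \<Rightarrow> real" where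
  "model Q x B \<mu> d =
     obj Q x + grad Q x \<bullet> d + 1 / 2 * (d \<bullet> (B *v d)) + \<mu> * norm (con Q x + jac Q x *v d)"

definition dq_N :: "('n::finite, 'p::finite) nlp \<Rightarrow> ('n, 'z::finite) ssarc_state \<Rightarrow> real" where
  "dq_N Q s = norm (con Q (pt s)) - norm (con Q (pt s) + jac Q (pt s) *v vert s)"

definition dq_H ::
  "('n::finite, 'p::finite) nlp \<Rightarrow> ('n, 'z::finite) ssarc_state \<Rightarrow> real^'n \<Rightarrow> real" where
  "dq_H Q s h =
     - ((grad Q (pt s) + hess s *v vert s) \<bullet> h) - 1 / 2 * (h \<bullet> (hess s *v h))"

definition dq_F :: "('n::finite, 'p::finite) nlp \<Rightarrow> ('n, 'z::finite) ssarc_state \<Rightarrow> real" where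
  "dq_F Q s = - (grad Q (pt s) \<bullet> vert s) - 1 / 2 * (vert s \<bullet> (hess s *v vert s))"

text \<open>The value \<open>\<mu>\<^sub>k\<close> computed for the trial with index \<open>i\<close>.\<close>

definition penalty ::
  "ssarc_params \<Rightarrow> ('n::finite, 'p::finite) nlp \<Rightarrow> ('n, 'z::finite) ssarc_state \<Rightarrow> nat \<Rightarrow> real"
where
  "penalty P Q s i =
     (let \<mu>c = - (dq_F Q s + dq_H Q s (h_step P Q s i)) / ((1 - nu P) * dq_N Q s)
      in if dq_N Q s \<noteq> 0 \<and> mu_prev s < \<mu>c
         then Max {\<mu>c, tau1 P * mu_prev s, mu_prev s + tau2 P}
         else mu_prev s)"

definition ratio ::
  "ssarc_params \<Rightarrow> ('n::finite, 'p::finite) nlp \<Rightarrow> ('n, 'z::finite) ssarc_state \<Rightarrow> nat \<Rightarrow> real"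
where
  "ratio P Q s i =
     (let x = pt s; d = d_step P Q s i; \<mu> = penalty P Q s i
      in (merit Q x \<mu> - merit Q (x + d) \<mu>) /
         (model Q x (hess s) \<mu> 0 - model Q x (hess s) \<mu> d))"

definition definite_shift :: "ssarc_params \<Rightarrow> ('n::finite, 'z::finite) ssarc_state \<Rightarrow> nat \<Rightarrow> bool"
where
  "definite_shift P s i \<longleftrightarrow>
     i \<le> last_shift P \<and> positive_definite (red_hess s + shift P i *\<^sub>R mat 1)"

text \<open>The search loop after a rejected trial: \<open>shift_search P Q s b j r j' r'\<close> says that the loop
  ``while \<open>r > \<gamma>\<^sub>1 b\<close> do \<open>r := \<parallel>u(\<lambda>\<^sub>j\<^sub>+\<^sub>1)\<parallel> / \<lambda>\<^sub>j\<^sub>+\<^sub>1\<close>; \<open>j := j + 1\<close>'', started with \<open>(j, r)\<close>,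
  ends with \<open>(j', r')\<close> without running out of shifts.\<close>

inductive shift_search ::
  "ssarc_params \<Rightarrow> ('n::finite, 'p::finite) nlp \<Rightarrow> ('n, 'z::finite) ssarc_state \<Rightarrow> real \<Rightarrow>
   nat \<Rightarrow> real \<Rightarrow> nat \<Rightarrow> real \<Rightarrow> bool"
  for P Q s b
where
  search_done: "r \<le> gamma1 P * b \<Longrightarrow> shift_search P Q s b j r j r"
| search_next: "r > gamma1 P * b \<Longrightarrow> Suc j \<le> last_shift P \<Longrightarrow>
     shift_search P Q s b (Suc j) (norm (u_step P Q s (Suc j)) / shift P (Suc j)) j' r' \<Longrightarrow>
     shift_search P Q s b j r j' r'"

text \<open>\<open>trial carry P Q s j b\<close>: the inner loop makes a trial with index \<open>j\<close>, the value of
  \<open>\<beta>\<^sub>k\<close> being \<open>b\<close> during this trial. The search after a rejected trial yields a reduced value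
  \<open>b'\<close> of \<open>\<beta>\<^sub>k\<^sub>+\<^sub>1\<close> while \<open>k\<close> is not advanced. There are two readings of the continuation.
  With \<open>carry = False\<close>, \<open>\<beta>\<^sub>k\<close> keeps its value throughout the outer iteration, so that
  \<open>b'\<close> only serves to find \<open>j'\<close>, \<open>\<beta>\<^sub>k\<^sub>+\<^sub>1\<close> being overwritten on acceptance. With
  \<open>carry = True\<close>, the reduced value replaces \<open>\<beta>\<^sub>k\<close> for the remaining trials and in the
  update on acceptance.\<close>

inductive trial ::
  "bool \<Rightarrow> ssarc_params \<Rightarrow> ('n::finite, 'p::finite) nlp \<Rightarrow> ('n, 'z::finite) ssarc_state \<Rightarrow>
   nat \<Rightarrow> real \<Rightarrow> bool"
  for carry P Q s
where
  trial_first: "definite_shift P s i \<Longrightarrow> i0 = (LEAST i. definite_shift P s i) \<Longrightarrow>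
     is_arg_min (\<lambda>i. \<bar>reg s * shift P i - norm (u_step P Q s i)\<bar>)
       (\<lambda>i. i0 \<le> i \<and> i \<le> last_shift P) j \<Longrightarrow>
     trial carry P Q s j (reg s)"
| trial_again: "trial carry P Q s j b \<Longrightarrow> ratio P Q s j < eta1 P \<Longrightarrow>
     shift_search P Q s b j b j' b' \<Longrightarrow>
     trial carry P Q s j' (if carry then b' else b)"

text \<open>One outer iteration from \<open>s\<close> to \<open>s'\<close>, in which the trial with index \<open>j\<close> and value \<open>b\<close>
  is accepted. The matrix \<open>hess s\<close> is an arbitrary symmetric matrix.\<close>

definition ssarc_iteration ::
  "bool \<Rightarrow> ssarc_params \<Rightarrow> ('n::finite, 'p::finite) nlp \<Rightarrow> ('n, 'z::finite) ssarc_state \<Rightarrow>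
   nat \<Rightarrow> real \<Rightarrow> ('n, 'z) ssarc_state \<Rightarrow> bool"
where
  "ssarc_iteration carry P Q s j b s' \<longleftrightarrow>
     \<not> kkt_point Q (pt s) \<and>
     transpose (hess s) = hess s \<and>
     nullspace_basis (jac Q (pt s)) (nullb s) \<and>
     vertical_step P Q (pt s) (reg s) (vert s) \<and>
     trial carry P Q s j b \<and>
     ratio P Q s j \<ge> eta1 P \<and>
     pt s' = pt s + d_step P Q s j \<and>
     reg s' = (if ratio P Q s j > eta2 P then gamma2 P * b else b) \<and>
     mu_prev s' = penalty P Q s j"

text \<open>An infinite run: \<open>S k\<close> is the state of outer iteration \<open>k\<close>, \<open>j k\<close> the index accepted
  in it, and \<open>b k\<close> the value of \<open>\<beta>\<^sub>k\<close> at the accepted trial.\<close>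

definition ssarc_run ::
  "bool \<Rightarrow> ssarc_params \<Rightarrow> ('n::finite, 'p::finite) nlp \<Rightarrow> (nat \<Rightarrow> ('n, 'z::finite) ssarc_state) \<Rightarrow>
   (nat \<Rightarrow> nat) \<Rightarrow> (nat \<Rightarrow> real) \<Rightarrow> bool"
where
  "ssarc_run carry P Q S j b \<longleftrightarrow>
     reg (S 0) > 0 \<and> mu_prev (S 0) > 0 \<and>
     (\<forall>k. ssarc_iteration carry P Q (S k) (j k) (b k) (S (Suc k)))"

text \<open>The requirements on a pair \<open>(\<lambda>, u)\<close> used with the value \<open>b\<close> of \<open>\<beta>\<^sub>k\<close>.\<close>

definition adequate_pair ::
  "ssarc_params \<Rightarrow> real \<Rightarrow> ('n::finite, 'p::finite) nlp \<Rightarrow> ('n, 'z::finite) ssarc_state \<Rightarrow>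
   real \<Rightarrow> real \<Rightarrow> real^'z \<Rightarrow> bool"
where
  "adequate_pair P t Q s b lam u \<longleftrightarrow>
     (let A = red_hess s + lam *\<^sub>R mat 1; r = red_grad Q s + A *v u in
        u \<bullet> (A *v u) \<ge> 0 \<and>
        1 / t * (norm u / b) \<le> lam \<and> lam \<le> t * (norm u / b) \<and>
        norm r \<le> xi P * (min (norm (red_grad Q s)) (norm u)) powr (1 + zeta P))"

end

theory Submission
  imports Defs
begin

text \<open>Dividing the merit decrease of an accepted step by \<open>\<mu>\<^sub>k\<close> gives a telescoping bound, so the
  normal decreases \<open>\<Delta>q\<^sub>k\<^sup>N \<ge> min {\<parallel>c\<^sub>k\<parallel>, \<theta> sqrt \<beta>\<^sub>k / \<kappa>\<^sub>n}\<close> are summable. If \<open>c\<^sub>k\<close> does not tend to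
  zero, then, whenever \<open>\<parallel>c\<^sub>k\<parallel> \<ge> \<epsilon>\<close>, the step length is of order \<open>sqrt \<beta>\<^sub>k\<close> and hence summable;
  as \<open>c\<close> is Lipschitz on the iterates, \<open>\<parallel>c\<^sub>k\<parallel>\<close> eventually stays above some \<open>\<epsilon>\<close>. The iterates then
  converge and \<open>\<beta>\<^sub>k\<close> tends to zero. Near the limit the functions are strictly differentiable, so
  the model error is \<open>o(sqrt \<beta>\<^sub>k)\<close> while the predicted decrease is at least of order \<open>sqrt \<beta>\<^sub>k\<close>: the
  first trial is very successful and \<open>\<beta>\<^sub>k\<^sub>+\<^sub>1 = \<gamma>\<^sub>2 \<beta>\<^sub>k > \<beta>\<^sub>k\<close>, a contradiction. Lipschitz continuity
  on the segments between iterates, which need not lie in \<open>C\<close>, is not available for a Taylor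
  estimate. At feasible iterates, where \<open>\<Delta>q\<^sub>k\<^sup>N = 0\<close>, the model decreases because CG residuals are
  orthogonal to the iterates.\<close>

subsection \<open>Matrices\<close>

lemma matrix_vector_mul_dot_transpose:
  fixes A :: "real^'n^'m"
  shows "(transpose A *v y) \<bullet> x = y \<bullet> (A *v x)"
  by (simp add: dot_lmul_matrix)

lemma symmetric_matrix_dot:
  fixes A :: "real^'n^'n"
  assumes "transpose A = A"
  shows "(A *v x) \<bullet> y = x \<bullet> (A *v y)"
  using matrix_vector_mul_dot_transpose[of A x y] assms by simp

text \<open>If \<open>A ** transpose A\<close> kills \<open>z\<close>, then
  \<open>transpose A *v z\<close> has norm zero, and full row rank makes \<open>transpose A\<close>
  injective.\<close>

lemma full_row_rank_inverse:
  fixes A :: "real^'n^'p"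
  assumes "rank A = CARD('p)"
  shows "A *v (transpose A *v (matrix_inv (A ** transpose A) *v y)) = y"
proof -
  let ?M = "A ** transpose A"
  have inj: "inj ((*v) (transpose A))"
    using assms by (simp add: full_rank_injective[symmetric] rank_transpose)
  have "z = 0" if "?M *v z = 0" for z
  proof -
    have "(transpose A *v z) \<bullet> (transpose A *v z) = z \<bullet> (?M *v z)"
      by (simp only: matrix_vector_mul_dot_transpose matrix_vector_mul_assoc)
    then have "transpose A *v z = transpose A *v 0"
      using that by (simp del: transpose_matrix_vector)
    then show "z = 0"
      by (rule injD[OF inj])
  qed
  then have "invertible ?M"
    by (metis invertible_left_inverse matrix_left_invertible_ker)
  then have "?M ** matrix_inv ?M = mat 1"
    unfolding invertible_def matrix_inv_def by (metis (mono_tags, lifting) someI)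
  then show ?thesis
    by (metis matrix_vector_mul_assoc matrix_vector_mul_lid)
qed

lemma nullspace_basis_kernel:
  assumes "nullspace_basis A Z"
  shows "A *v (Z *v u) = 0"
proof -
  have "Z *v u \<in> span (columns Z)"
    by (rule matrix_vector_mult_in_columnspace)
  then show ?thesis
    using assms by (simp add: nullspace_basis_def)
qed

text \<open>Pythagoras over orthogonal columns; no equality, as a column may be zero.\<close>

lemma nullspace_basis_norm_le:
  assumes "nullspace_basis A Z"
  shows "norm (Z *v u) \<le> norm u"
proof -
  have "(norm (Z *v u))\<^sup>2 = (\<Sum>i\<in>UNIV. (norm (u $ i *\<^sub>R column i Z))\<^sup>2)"
    unfolding matrix_mult_sum scalar_mult_eq_scaleR
    using assms by (subst norm_sum_Pythagorean)
      (auto simp: nullspace_basis_def pairwise_def orthogonal_clauses)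
  also have "\<dots> \<le> (\<Sum>i\<in>UNIV. (u $ i)\<^sup>2)"
  proof (rule sum_mono)
    fix i
    have "norm (column i Z) = 0 \<or> norm (column i Z) = 1"
      using assms by (auto simp: nullspace_basis_def)
    then show "(norm (u $ i *\<^sub>R column i Z))\<^sup>2 \<le> (u $ i)\<^sup>2"
      by auto
  qed
  also have "\<dots> = (norm u)\<^sup>2"
    by (simp add: norm_vec_def L2_set_def sum_nonneg)
  finally show ?thesis
    by (rule power2_le_imp_le) simp
qed

lemma bounded_bilinear_matrix_vector_mult:
  "bounded_bilinear ((*v) :: real^'n^'m \<Rightarrow> real^'n \<Rightarrow> real^'m)"
  unfolding bilinear_conv_bounded_bilinear[symmetric] bilinear_def
  by (auto intro!: linearI simp: matrix_vector_right_distrib matrix_vector_mult_scaleR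
      matrix_vector_mult_add_rdistrib scaleR_matrix_vector_assoc)

lemma norm_matrix_vector_le:
  fixes A :: "real^'n^'m"
  assumes "onorm ((*v) A) \<le> c"
  shows "norm (A *v x) \<le> c * norm x"
proof -
  have "norm (A *v x) \<le> onorm ((*v) A) * norm x"
    by (rule onorm) simp
  then show ?thesis
    using assms by (meson mult_right_mono norm_ge_zero order_trans)
qed

subsection \<open>Strict differentiability of continuously differentiable maps\<close>

text \<open>A general bilinear \<open>p\<close> covers both the gradient with \<open>inner\<close>
  and the Jacobian with \<open>*v\<close>. Continuity of \<open>G\<close> makes the derivative
  almost constant near \<open>z\<close>, and the mean value inequality applies on the convex
  ball.\<close>

lemma strict_differentiability:
  fixes F :: "'a::real_normed_vector \<Rightarrow> 'b::real_normed_vector"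
    and G :: "'a \<Rightarrow> 'c::real_normed_vector"
  assumes bil: "bounded_bilinear p"
    and der: "\<And>x. (F has_derivative p (G x)) (at x)"
    and cont: "continuous_on UNIV G" and "e > 0"
  obtains r where "r > 0"
    "\<And>x y. x \<in> ball z r \<Longrightarrow> y \<in> ball z r \<Longrightarrow>
       norm (F y - F x - p (G x) (y - x)) \<le> e * norm (y - x)"
proof -
  interpret bounded_bilinear p by fact
  obtain K where "K > 0" and K: "\<And>a b. norm (p a b) \<le> norm a * norm b * K"
    using pos_bounded by blast
  \<comment> \<open>Two such distances, added through \<open>G z\<close>, give \<open>e / K\<close>,
    and \<open>K\<close> bounds \<open>p\<close>.\<close>
  have "isCont G z" "e / (2 * K) > 0"
    using cont \<open>e > 0\<close> \<open>K > 0\<close> by (simp_all add: continuous_on_eq_continuous_at)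
  then obtain r where "r > 0" and r: "\<And>x. dist x z < r \<Longrightarrow> dist (G x) (G z) < e / (2 * K)"
    unfolding continuous_at_eps_delta by blast
  show thesis
  proof (rule that)
    fix x y assume xy: "x \<in> ball z r" "y \<in> ball z r"
    have "norm (F y - F x - p (G x) (y - x)) \<le> norm (y - x) * e"
    proof (rule differentiable_bound_linearization[where S = "ball z r" and f' = "\<lambda>w. p (G w)"])
      fix t :: real assume "t \<in> {0..1}"
      then show "x + t *\<^sub>R (y - x) \<in> ball z r"
        using convexD_alt[OF convex_ball xy, of t] by (simp add: algebra_simps)
    next
      fix w assume w: "w \<in> ball z r"
      show "(F has_derivative p (G w)) (at w within ball z r)"
        using der has_derivative_at_withinI by blast
      have "dist (G w) (G x) < e / (2 * K) + e / (2 * K)"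
        using r[of w] r[of x] w xy by (intro dist_triangle_less_add[of _ "G z"])
          (simp_all add: dist_commute)
      then have le: "norm (G w - G x) * K \<le> e"
        using \<open>K > 0\<close> by (simp add: dist_norm field_simps)
      show "onorm (p (G w) - p (G x)) \<le> e"
      proof (intro onorm_bound)
        fix h
        have "norm ((p (G w) - p (G x)) h) \<le> norm (G w - G x) * norm h * K"
          using K[of "G w - G x" h] by (simp add: diff_left)
        also have "\<dots> = (norm (G w - G x) * K) * norm h"
          by simp
        finally show "norm ((p (G w) - p (G x)) h) \<le> e * norm h"
          using le by (meson mult_right_mono norm_ge_zero order_trans)
      qed (use \<open>e > 0\<close> in simp)
    qed (use xy in auto)
    then show "norm (F y - F x - p (G x) (y - x)) \<le> e * norm (y - x)"
      by (simp add: mult.commute)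
  qed (fact \<open>r > 0\<close>)
qed

subsection \<open>Orthogonality in the shifted CG-Lanczos iteration\<close>

text \<open>The product \<open>a\<^sub>l\<^sub>+\<^sub>1 \<upsilon>\<^sub>l\<^sub>+\<^sub>1\<close> satisfies the three-term recurrence even
  after a breakdown, where both factors are zero.\<close>

definition lanczos_pred :: "real^'z::finite^'z \<Rightarrow> real^'z \<Rightarrow> nat \<Rightarrow> real^'z" where
  "lanczos_pred B b l = fst (snd (lanczos B b l))"

lemma lanczos_pred_simps [simp]:
  "lanczos_pred B b 0 = 0" "lanczos_pred B b (Suc l) = lanczos_vec B b l"
  by (simp_all add: lanczos_pred_def lanczos_vec_def Let_def split: prod.splits)

lemma lanczos_recurrence:
  "lanczos_coeff B b (Suc l) *\<^sub>R lanczos_vec B b (Suc l) =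
     B *v lanczos_vec B b l - (lanczos_vec B b l \<bullet> (B *v lanczos_vec B b l)) *\<^sub>R lanczos_vec B b l
       - lanczos_coeff B b l *\<^sub>R lanczos_pred B b l"
proof -
  have "norm s *\<^sub>R (s /\<^sub>R norm s) = s" for s :: "real^'a"
    by (cases "s = 0") simp_all
  then show ?thesis
    by (simp add: lanczos_pred_def lanczos_vec_def lanczos_coeff_def Let_def del: scaleR_scaleR
        split: prod.splits)
qed

text \<open>Normalizing a zero vector gives zero, so this dichotomy stands in for unit
  length.\<close>

lemma lanczos_normalized:
  "lanczos_vec B b l = 0 \<and> lanczos_coeff B b l = 0
     \<or> norm (lanczos_vec B b l) = 1 \<and> lanczos_coeff B b l \<noteq> 0"
  by (cases l) (auto simp: lanczos_vec_def lanczos_coeff_def Let_def split: prod.splits)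

lemma lanczos_vec_0: "norm b *\<^sub>R lanczos_vec B b 0 = - b"
  by (cases "b = 0") (simp_all add: lanczos_vec_def)

lemma lanczos_breakdown:
  assumes "lanczos_vec B b l = 0"
  shows "lanczos_vec B b (Suc l) = 0"
proof -
  have "lanczos_coeff B b l = 0"
    using assms lanczos_normalized[of B b l] by auto
  then have "lanczos_coeff B b (Suc l) *\<^sub>R lanczos_vec B b (Suc l) = 0"
    using assms by (simp add: lanczos_recurrence)
  then show ?thesis
    using lanczos_normalized[of B b "Suc l"] by auto
qed

text \<open>Test the recurrence against an earlier vector, move the symmetric \<open>B\<close>
  across and expand again: only neighbouring vectors survive, and their terms cancel.\<close>

lemma lanczos_orthogonal:
  assumes sym: "transpose B = B" and "i < l"
  shows "lanczos_vec B b l \<bullet> lanczos_vec B b i = 0"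
  using \<open>i < l\<close>
proof (induction l arbitrary: i rule: less_induct)
  case (less m)
  let ?y = "lanczos_vec B b" and ?a = "lanczos_coeff B b"
  obtain l where m: "m = Suc l"
    using less.prems by (cases m) auto
  have IH: "?y l' \<bullet> ?y i' = 0" if "l' \<le> l" "i' \<le> l" "l' \<noteq> i'" for l' i'
    using less.IH[of l' i'] less.IH[of i' l'] that m
    by (cases "i' < l'") (auto simp: inner_commute)
  define d where "d k = ?y k \<bullet> (B *v ?y k)" for k
  have rec: "B *v ?y k = ?a (Suc k) *\<^sub>R ?y (Suc k) + d k *\<^sub>R ?y k + ?a k *\<^sub>R lanczos_pred B b k" for k
    unfolding lanczos_recurrence d_def by simp
  have ya: "?a k * (?y k \<bullet> ?y k) = ?a k" for k
    using lanczos_normalized[of B b k] by (auto simp: dot_square_norm)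
  have "?a (Suc l) * (?y (Suc l) \<bullet> ?y i)
      = ?y l \<bullet> (B *v ?y i) - d l * (?y l \<bullet> ?y i) - ?a l * (lanczos_pred B b l \<bullet> ?y i)"
    (is "_ = ?rhs")
    using lanczos_recurrence[of B b l, THEN arg_cong, of "\<lambda>v. v \<bullet> ?y i"]
    by (simp add: d_def inner_diff_left symmetric_matrix_dot[OF sym])
  \<comment> \<open>The second alternative sets a breakdown aside, after which all later vectors
    vanish.\<close>
  also have "?rhs = 0 \<or> ?y l = 0"
  proof (cases "i = l")
    case True
    have "lanczos_pred B b l \<bullet> ?y l = 0"
      using IH by (cases l) auto
    moreover have "d l = d l * (?y l \<bullet> ?y l)"
      using lanczos_normalized[of B b l] by (auto simp: dot_square_norm d_def)
    ultimately show ?thesis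
      using True by (simp add: d_def)
  next
    case False
    then have il: "i < l"
      using less.prems m by simp
    then obtain l' where l: "l = Suc l'"
      by (cases l) auto
    have pred: "?y l \<bullet> lanczos_pred B b i = 0"
      using IH il by (cases i) auto
    have eq: "?rhs = ?a (Suc i) * (?y l \<bullet> ?y (Suc i)) - ?a l * (?y l' \<bullet> ?y i)"
      using IH[of l i] il pred unfolding rec by (simp add: inner_add_right l)
    show ?thesis
    proof (cases "i = l'")
      case True
      show ?thesis
      proof (cases "?y l = 0")
        case False
        then have "?y l' \<bullet> ?y l' = 1"
          using lanczos_normalized[of B b l'] lanczos_breakdown[of B b l']
          by (auto simp: l dot_square_norm)
        then show ?thesis
          using eq True ya[of l] by (simp add: l)
      qed simp
    next
      case False
      then show ?thesis
        using eq IH[of l "Suc i"] IH[of l' i] il l by auto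
    qed
  qed
  finally have "?a (Suc l) = 0 \<or> ?y (Suc l) \<bullet> ?y i = 0 \<or> ?y l = 0"
    by auto
  moreover have "?y (Suc l) = 0" if "?a (Suc l) = 0"
    using lanczos_normalized[of B b "Suc l"] that by auto
  ultimately show ?case
    using lanczos_breakdown[of B b l] m by auto
qed

section \<open>Residuals and search spaces of shifted CG\<close>

definition cg_dir :: "real^'z::finite^'z \<Rightarrow> real^'z \<Rightarrow> real \<Rightarrow> nat \<Rightarrow> real^'z" where
  "cg_dir B b lam l = fst (snd (cg_state B b lam l))"

definition cg_sigma :: "real^'z::finite^'z \<Rightarrow> real^'z \<Rightarrow> real \<Rightarrow> nat \<Rightarrow> real" where
  "cg_sigma B b lam l = fst (snd (snd (cg_state B b lam l)))"

text \<open>The pivot depends on the two values only through this quotient, which after the first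
  step is the squared Lanczos coefficient times the previous \<open>\<pi>\<close>, zero pivots
  included.\<close>

definition cg_quot :: "real^'z::finite^'z \<Rightarrow> real^'z \<Rightarrow> real \<Rightarrow> nat \<Rightarrow> real" where
  "cg_quot B b lam l =
     fst (snd (snd (snd (cg_state B b lam l)))) / snd (snd (snd (snd (cg_state B b lam l))))"

lemma cg_simps:
  "cg_iterate B b lam 0 = 0"
  "cg_dir B b lam 0 = - b"
  "cg_sigma B b lam 0 = norm b"
  "cg_quot B b lam 0 = 0"
  "cg_iterate B b lam (Suc l) = cg_iterate B b lam l + cg_pi B b lam l *\<^sub>R cg_dir B b lam l"
  "cg_dir B b lam (Suc l) = cg_sigma B b lam (Suc l) *\<^sub>R lanczos_vec B b (Suc l)
     + (lanczos_coeff B b (Suc l) * cg_pi B b lam l)\<^sup>2 *\<^sub>R cg_dir B b lam l"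
  "cg_sigma B b lam (Suc l) = - lanczos_coeff B b (Suc l) * cg_pi B b lam l * cg_sigma B b lam l"
  "cg_quot B b lam (Suc l) = (lanczos_coeff B b (Suc l))\<^sup>2 * cg_pi B b lam l"
  "cg_pi B b lam l =
     1 / (lanczos_vec B b l \<bullet> (B *v lanczos_vec B b l) + lam - cg_quot B b lam l)"
  by (simp_all add: cg_iterate_def cg_dir_def cg_sigma_def cg_quot_def cg_pi_def Let_def
      power2_eq_square split: prod.splits)

text \<open>The values \<open>1 / \<pi>\<close> are the pivots of the LDL factorization of the
  shifted tridiagonal Lanczos matrix; hence only two consecutive Lanczos vectors survive in the
  image of a direction.\<close>

lemma cg_dir_image:
  "(B + lam *\<^sub>R mat 1) *v cg_dir B b lam l =
     (cg_sigma B b lam l / cg_pi B b lam l) *\<^sub>R lanczos_vec B b l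
     + (cg_sigma B b lam l * lanczos_coeff B b (Suc l)) *\<^sub>R lanczos_vec B b (Suc l)"
proof -
  let ?y = "lanczos_vec B b" and ?a = "lanczos_coeff B b" and ?A = "B + lam *\<^sub>R mat 1"
    and ?s = "cg_sigma B b lam" and ?p = "cg_pi B b lam"
  define d where "d k = ?y k \<bullet> (B *v ?y k) + lam" for k
  have rec: "?A *v ?y k = ?a (Suc k) *\<^sub>R ?y (Suc k) + d k *\<^sub>R ?y k + ?a k *\<^sub>R lanczos_pred B b k" for k
    unfolding lanczos_recurrence d_def
    by (simp add: matrix_vector_mult_add_rdistrib scaleR_matrix_vector_assoc[symmetric] algebra_simps)
  \<comment> \<open>Since \<open>1 / 0 = 0\<close>, this covers a zero pivot as well.\<close>
  have inv: "1 / ?p k = d k - cg_quot B b lam k" for k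
    by (simp add: cg_simps(9) d_def)
  show ?thesis
  proof (induction l)
    case 0
    have "- b = norm b *\<^sub>R ?y 0"
      by (simp add: lanczos_vec_0)
    then show ?case
      using rec[of 0] inv[of 0]
      by (simp add: cg_simps(2-4) matrix_vector_mult_scaleR algebra_simps divide_inverse)
  next
    case (Suc l)
    let ?o = "(?a (Suc l) * ?p l)\<^sup>2"
    have 1: "?s (Suc l) * ?a (Suc l) + ?o * (?s l / ?p l) = 0"
      by (simp add: cg_simps(7) power2_eq_square field_simps)
    have 2: "?s (Suc l) * d (Suc l) + ?o * (?s l * ?a (Suc l)) = ?s (Suc l) / ?p (Suc l)"
    proof -
      have "d (Suc l) = 1 / ?p (Suc l) + (?a (Suc l))\<^sup>2 * ?p l"
        using inv[of "Suc l"] by (simp add: cg_simps(8))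
      then show ?thesis
        by (simp add: cg_simps(7) power2_eq_square algebra_simps)
    qed
    have "?A *v cg_dir B b lam (Suc l) = ?s (Suc l) *\<^sub>R (?A *v ?y (Suc l))
        + ?o *\<^sub>R (?A *v cg_dir B b lam l)"
      unfolding cg_simps(6) by (simp add: matrix_vector_right_distrib matrix_vector_mult_scaleR)
    also have "\<dots> = (?s (Suc l) * ?a (Suc l) + ?o * (?s l / ?p l)) *\<^sub>R ?y l
        + (?s (Suc l) * d (Suc l) + ?o * (?s l * ?a (Suc l))) *\<^sub>R ?y (Suc l)
        + (?s (Suc l) * ?a (Suc (Suc l))) *\<^sub>R ?y (Suc (Suc l))"
      unfolding Suc.IH rec by (simp add: algebra_simps)
    finally show ?case
      unfolding 1 2 by simp
  qed
qed

text \<open>For nonzero \<open>\<pi>\<close>, the image of the new increment cancels the old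
  residual and leaves a multiple of the next Lanczos vector.\<close>

lemma cg_residual:
  assumes "\<And>i. i < l \<Longrightarrow> cg_pi B b lam i \<noteq> 0"
  shows "b + (B + lam *\<^sub>R mat 1) *v cg_iterate B b lam l = - cg_sigma B b lam l *\<^sub>R lanczos_vec B b l"
  using assms
proof (induction l)
  case 0
  then show ?case
    by (simp add: cg_simps lanczos_vec_0)
next
  case (Suc l)
  then show ?case
    by (simp add: cg_simps(5,7) matrix_vector_right_distrib matrix_vector_mult_scaleR cg_dir_image
        scaleR_add_right flip: add.assoc)
qed

text \<open>The iterate uses strictly earlier vectors than the one carrying its residual; this gap
  gives their orthogonality.\<close>

lemma cg_span:
  "cg_dir B b lam l \<in> span (lanczos_vec B b ` {..l})"
  "cg_iterate B b lam l \<in> span (lanczos_vec B b ` {..<l})"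
proof -
  show dir: "cg_dir B b lam l \<in> span (lanczos_vec B b ` {..l})" for l
  proof (induction l)
    case 0
    have "cg_dir B b lam 0 = norm b *\<^sub>R lanczos_vec B b 0"
      by (simp add: cg_simps lanczos_vec_0)
    then show ?case
      by (simp add: span_base span_scale)
  next
    case (Suc l)
    then have "cg_dir B b lam l \<in> span (lanczos_vec B b ` {..Suc l})"
      by (rule subsetD[OF span_mono, rotated]) auto
    then show ?case
      unfolding cg_simps(6) by (intro span_add span_scale) (auto intro: span_base)
  qed
  show "cg_iterate B b lam l \<in> span (lanczos_vec B b ` {..<l})"
  proof (induction l)
    case 0
    then show ?case by (simp add: cg_simps)
  next
    case (Suc l)
    then have "cg_iterate B b lam l \<in> span (lanczos_vec B b ` {..<Suc l})"
      by (rule subsetD[OF span_mono, rotated]) auto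
    then show ?case
      using dir[of l] unfolding cg_simps(5) by (intro span_add span_scale) (auto simp: lessThan_Suc_atMost)
  qed
qed

lemma cg_lanczos_residual_orthogonal:
  fixes B :: "real^'z^'z"
  assumes "transpose B = B"
    and w_def: "w = cg_lanczos P B b lam"
  shows "(b + (B + lam *\<^sub>R mat 1) *v w) \<bullet> w = 0"
proof -
  define l where "l = (LEAST l. cg_stops P B b lam l)"
  have w: "w = cg_iterate B b lam l"
    by (simp add: w_def cg_lanczos_def l_def)
  \<comment> \<open>No index below the \<open>LEAST\<close> passes the stopping test, so each such
    \<open>\<pi>\<close> is positive.\<close>
  have "cg_pi B b lam i \<noteq> 0" if "i < l" for i
    using not_less_Least[OF that[unfolded l_def]] by (auto simp: cg_stops_def Let_def)
  then have res: "b + (B + lam *\<^sub>R mat 1) *v w = - cg_sigma B b lam l *\<^sub>R lanczos_vec B b l"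
    unfolding w by (rule cg_residual)
  have "orthogonal (lanczos_vec B b l) w"
    unfolding w using lanczos_orthogonal[OF assms(1)]
    by (intro orthogonal_to_span[OF cg_span(2)]) (auto simp: orthogonal_def)
  then show ?thesis
    by (simp add: res orthogonal_def)
qed

subsection \<open>Trials\<close>

lemma shift_pos: "0 < shift P i"
  by (induction i) simp_all

lemma shift_mono:
  assumes "i \<le> k"
  shows "shift P i \<le> shift P k"
proof (rule lift_Suc_mono_le[OF _ assms])
  fix n
  have "(1::real) \<le> 10 powr (1 / 2)"
    by (rule ge_one_powr_ge_zero) simp_all
  then show "shift P n \<le> shift P (Suc n)"
    using mult_right_mono[of 1 "10 powr (1 / 2)" "shift P n"] shift_pos[of P n] by simp
qed

lemma shift_search_result:
  assumes "shift_search P Q s b j r j' r'" "j \<le> last_shift P"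
  shows "j \<le> j' \<and> j' \<le> last_shift P \<and> r' \<le> gamma1 P * b \<and>
    (j' = j \<and> r' = r \<or> r' = norm (u_step P Q s j') / shift P j')"
  using assms by (induction rule: shift_search.induct) auto

text \<open>Facts at the start of one inner loop; positivity of \<open>reg s\<close> and
  \<open>mu_prev s\<close> is obtained later by induction along the run.\<close>

locale outer_iteration =
  fixes P :: ssarc_params and Q :: "('n::finite, 'p::finite) nlp"
    and s :: "('n, 'z::finite) ssarc_state"
  assumes valid: "valid_params P"
    and full_rank: "rank (jac Q (pt s)) = CARD('p)"
    and hess_symmetric: "transpose (hess s) = hess s"
    and nullb: "nullspace_basis (jac Q (pt s)) (nullb s)"
    and vertical: "vertical_step P Q (pt s) (reg s) (vert s)"
    and reg_pos: "0 < reg s"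
    and mu_prev_pos: "0 < mu_prev s"
begin

lemma params:
  "0 < eta1 P" "eta1 P < eta2 P" "eta2 P < 1" "0 < gamma1 P" "gamma1 P < 1" "1 < gamma2 P"
  "0 < nu P" "nu P < 1" "0 < tau2 P" "0 < theta P"
  using valid by (simp_all add: valid_params_def)

text \<open>Rejections never enlarge \<open>b\<close>, but may bring it to zero if a searched step
  vanishes.\<close>

lemma trial_bounds:
  assumes "trial carry P Q s j b"
  shows "j \<le> last_shift P" "0 \<le> b" "b \<le> reg s"
proof -
  have "j \<le> last_shift P \<and> 0 \<le> b \<and> b \<le> reg s"
    using assms
  proof (induction rule: trial.induct)
    case (trial_first i i0 j)
    then show ?case
      using reg_pos by (simp add: is_arg_min_def)
  next
    case (trial_again j b j' b')
    have "j' \<le> last_shift P" "b' \<le> gamma1 P * b"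
      "b' = b \<or> b' = norm (u_step P Q s j') / shift P j'"
      using shift_search_result[OF trial_again.hyps(3)] trial_again.IH by auto
    moreover have "gamma1 P * b \<le> b"
      using params trial_again.IH by (simp add: mult_left_le_one_le)
    moreover have "0 \<le> norm (u_step P Q s j') / shift P j'"
      using shift_pos[of P j'] by simp
    ultimately show ?case
      using trial_again.IH by auto
  qed
  then show "j \<le> last_shift P" "0 \<le> b" "b \<le> reg s"
    by auto
qed

text \<open>Nothing is assumed about the first trial if it is rejected. If the search for another
  shift succeeds, however, then the choice of the first shift among all candidates bounds the
  step of the first trial.\<close>

lemma trial_reg_or_rejected:
  assumes "trial carry P Q s j b"
  shows "b = reg s \<or>
    (\<exists>i. norm (u_step P Q s i) \<le> 2 * shift P (last_shift P) * reg s \<and> ratio P Q s i < eta1 P)"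
    (is "_ \<or> ?rejected")
proof -
  define dev where "dev i = \<bar>reg s * shift P i - norm (u_step P Q s i)\<bar>" for i
  \<comment> \<open>Strengthened for the induction: until a short step has been rejected, the index
    is still the minimizing first choice.\<close>
  have "(b = reg s \<and> (\<exists>i0. is_arg_min dev (\<lambda>i. i0 \<le> i \<and> i \<le> last_shift P) j)) \<or> ?rejected"
    using assms
  proof (induction rule: trial.induct)
    case (trial_first i i0 j)
    then show ?case
      unfolding dev_def by blast
  next
    case (trial_again j b j' b')
    show ?case
    proof (cases ?rejected)
      case False
      then obtain i0 where b: "b = reg s"
        and j: "is_arg_min dev (\<lambda>i. i0 \<le> i \<and> i \<le> last_shift P) j"
        using trial_again.IH by blast
      have j': "j \<le> j'" "j' \<le> last_shift P" "b' \<le> gamma1 P * reg s"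
        "b' = reg s \<or> b' = norm (u_step P Q s j') / shift P j'"
        using shift_search_result[OF trial_again.hyps(3)] j b by (auto simp: is_arg_min_def)
      \<comment> \<open>The search returns at most \<open>gamma1 P * reg s\<close>, so it cannot
        have ended at once, and its result is the quotient at \<open>j'\<close>.\<close>
      have less: "gamma1 P * reg s < reg s"
        using params reg_pos by simp
      with j' have "norm (u_step P Q s j') / shift P j' \<le> reg s"
        by auto
      then have "dev j' \<le> reg s * shift P j'"
        using shift_pos[of P j'] by (simp add: dev_def field_simps abs_le_iff)
      moreover have "dev j \<le> dev j'"
        using j j' by (auto simp: is_arg_min_def not_less)
      moreover
      have "reg s * shift P i \<le> reg s * shift P (last_shift P)" if "i \<le> last_shift P" for i
        using shift_mono[OF that] reg_pos by simp
      note this[OF j'(2)] this[OF order_trans[OF j'(1,2)]]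
      \<comment> \<open>One summand bounds \<open>dev j\<close>, the other
        \<open>reg s * shift P j\<close>; hence the factor 2.\<close>
      ultimately have "norm (u_step P Q s j) \<le> 2 * shift P (last_shift P) * reg s"
        unfolding dev_def by (simp add: mult_ac)
      then show ?thesis
        using trial_again.hyps(2) by blast
    qed simp
  qed
  then show ?thesis by blast
qed

subsection \<open>The predicted decrease\<close>

lemma jac_cauchy_vert: "jac Q (pt s) *v cauchy_vert Q (pt s) = - con Q (pt s)"
  unfolding cauchy_vert_def
  using full_row_rank_inverse[OF full_rank, of "con Q (pt s)"]
  by (simp add: bounded_bilinear.minus_right[OF bounded_bilinear_matrix_vector_mult]
      del: transpose_matrix_vector)

text \<open>The Jacobian maps the full vertical step to minus the constraint value, so scaling by
  \<alpha> leaves the residual \<open>(1 - \<alpha>) *\<^sub>R con Q (pt s)\<close>.\<close>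

lemma vertical_scaling:
  obtains \<alpha> where "0 < \<alpha>" "\<alpha> \<le> 1" "vert s = \<alpha> *\<^sub>R cauchy_vert Q (pt s)"
    "norm (vert s) \<le> sqrt (reg s)" "dq_N Q s = \<alpha> * norm (con Q (pt s))"
    "cauchy_vert Q (pt s) \<noteq> 0 \<Longrightarrow>
       min 1 (theta P * sqrt (reg s) / norm (cauchy_vert Q (pt s))) \<le> \<alpha>"
proof -
  let ?vc = "cauchy_vert Q (pt s)"
  obtain a where a: "vert s = a *\<^sub>R ?vc"
    "?vc \<noteq> 0 \<Longrightarrow> a \<in> {min 1 (theta P * sqrt (reg s) / norm ?vc) .. min 1 (sqrt (reg s) / norm ?vc)}"
    using vertical unfolding vertical_step_def Let_def by blast
  \<comment> \<open>For a zero full step the scalar is arbitrary; the value 1 satisfies all the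
    bounds.\<close>
  define \<alpha> where "\<alpha> = (if ?vc = 0 then 1 else a)"
  have v: "vert s = \<alpha> *\<^sub>R ?vc"
    using a by (simp add: \<alpha>_def)
  have lower: "min 1 (theta P * sqrt (reg s) / norm ?vc) \<le> \<alpha>" if "?vc \<noteq> 0"
    using a(2)[OF that] that by (simp add: \<alpha>_def)
  have upper: "\<alpha> \<le> sqrt (reg s) / norm ?vc" if "?vc \<noteq> 0"
    using a(2)[OF that] that by (simp add: \<alpha>_def)
  have "\<alpha> \<le> 1"
    using a(2) by (auto simp: \<alpha>_def)
  have "0 < \<alpha>"
  proof (cases "?vc = 0")
    case False
    then have "0 < min 1 (theta P * sqrt (reg s) / norm ?vc)"
      using params reg_pos by simp
    then show ?thesis
      using lower[OF False] by linarith
  qed (simp add: \<alpha>_def)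
  have "norm (vert s) \<le> sqrt (reg s)"
  proof (cases "?vc = 0")
    case False
    then show ?thesis
      using upper \<open>0 < \<alpha>\<close> by (simp add: v field_simps)
  qed (use v reg_pos in simp)
  moreover have eq: "con Q (pt s) + jac Q (pt s) *v vert s = (1 - \<alpha>) *\<^sub>R con Q (pt s)"
    by (simp add: v matrix_vector_mult_scaleR jac_cauchy_vert algebra_simps)
  have "dq_N Q s = \<alpha> * norm (con Q (pt s))"
    using \<open>\<alpha> \<le> 1\<close> by (simp add: dq_N_def eq left_diff_distrib)
  ultimately show thesis
    using that \<open>0 < \<alpha>\<close> \<open>\<alpha> \<le> 1\<close> v lower by blast
qed

lemma norm_vert_le: "norm (vert s) \<le> sqrt (reg s)"
  by (rule vertical_scaling)

lemma norm_d_step_le: "norm (d_step P Q s i) \<le> sqrt (reg s) + norm (u_step P Q s i)"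
  unfolding d_step_def h_step_def
  using norm_vert_le nullspace_basis_norm_le[OF nullb] norm_triangle_mono by blast

lemma dq_N_nonneg: "0 \<le> dq_N Q s"
  by (rule vertical_scaling) simp

lemma vert_eq_0:
  assumes "dq_N Q s = 0"
  shows "vert s = 0"
proof -
  obtain \<alpha> where "0 < \<alpha>" "vert s = \<alpha> *\<^sub>R cauchy_vert Q (pt s)"
    "dq_N Q s = \<alpha> * norm (con Q (pt s))"
    using vertical_scaling by metis
  then show ?thesis
    using assms by (simp add: cauchy_vert_def)
qed

text \<open>Multiply the lower bound on \<alpha> by the norm of the constraint value, which is at
  least \<open>1 / \<kappa>\<close> times that of the full vertical step.\<close>

lemma dq_N_ge:
  assumes "norm (cauchy_vert Q (pt s)) \<le> \<kappa> * norm (con Q (pt s))" "0 < \<kappa>"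
  shows "min (norm (con Q (pt s))) (theta P * sqrt (reg s) / \<kappa>) \<le> dq_N Q s"
proof -
  let ?vc = "cauchy_vert Q (pt s)" and ?c = "con Q (pt s)" and ?r = "theta P * sqrt (reg s)"
  obtain \<alpha> where \<alpha>: "dq_N Q s = \<alpha> * norm ?c" "?vc \<noteq> 0 \<Longrightarrow> min 1 (?r / norm ?vc) \<le> \<alpha>"
    using vertical_scaling by metis
  show ?thesis
  proof (cases "?vc = 0")
    case True
    then have "?c = 0"
      using jac_cauchy_vert by simp
    then show ?thesis
      using \<alpha> by simp
  next
    case False
    then have c: "?c \<noteq> 0"
      by (auto simp: cauchy_vert_def)
    then have "?r / \<kappa> = (?r * norm ?c) / (\<kappa> * norm ?c)"
      by simp
    also have "\<dots> \<le> (?r * norm ?c) / norm ?vc"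
      using assms False c params reg_pos by (intro divide_left_mono) auto
    finally have r: "?r / \<kappa> \<le> ?r / norm ?vc * norm ?c"
      by simp
    have "min 1 (?r / norm ?vc) * norm ?c \<le> \<alpha> * norm ?c"
      using \<alpha>(2)[OF False] by (simp add: mult_right_mono)
    then show ?thesis
      using r \<alpha>(1) by (auto simp: min_def split: if_splits)
  qed
qed

text \<open>The horizontal step lies in the null space of the Jacobian, so the constraint term sees
  only \<open>vert s\<close>; symmetry of \<open>hess s\<close> puts the cross terms into
  \<open>dq_H\<close>.\<close>

lemma model_decrease:
  "model Q (pt s) (hess s) \<mu> 0 - model Q (pt s) (hess s) \<mu> (d_step P Q s i) =
     dq_H Q s (h_step P Q s i) + \<mu> * dq_N Q s + dq_F Q s"
proof -
  let ?v = "vert s" and ?h = "h_step P Q s i" and ?B = "hess s"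
  have "jac Q (pt s) *v (?v + ?h) = jac Q (pt s) *v ?v"
    by (simp add: matrix_vector_right_distrib h_step_def nullspace_basis_kernel[OF nullb])
  moreover have "?h \<bullet> (?B *v ?v) = ?v \<bullet> (?B *v ?h)"
    using symmetric_matrix_dot[OF hess_symmetric, of ?v ?h] by (simp add: inner_commute)
  ultimately show ?thesis
    by (simp add: model_def d_step_def dq_H_def dq_F_def dq_N_def matrix_vector_right_distrib
        symmetric_matrix_dot[OF hess_symmetric] inner_add algebra_simps)
qed

text \<open>Orthogonality of residual and iterate turns the decrease into half the shifted quadratic
  form at \<open>u\<close> plus half the shift times the squared norm of \<open>u\<close>.\<close>

lemma dq_H_nonneg:
  assumes "0 \<le> u_step P Q s i \<bullet> ((red_hess s + shift P i *\<^sub>R mat 1) *v u_step P Q s i)"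
  shows "0 \<le> dq_H Q s (h_step P Q s i)"
proof -
  let ?u = "u_step P Q s i" and ?g = "red_grad Q s" and ?B = "red_hess s"
  have "transpose ?B = ?B"
    unfolding red_hess_def matrix_transpose_mul transpose_transpose hess_symmetric
    by (rule matrix_mul_assoc)
  then have "(?g + (?B + shift P i *\<^sub>R mat 1) *v ?u) \<bullet> ?u = 0"
    by (rule cg_lanczos_residual_orthogonal) (simp add: u_step_def)
  then have 1: "?g \<bullet> ?u = - (?u \<bullet> ((?B + shift P i *\<^sub>R mat 1) *v ?u))"
    unfolding inner_add_left by (simp add: inner_commute[of ?u])
  have 2: "?u \<bullet> ((?B + shift P i *\<^sub>R mat 1) *v ?u) = ?u \<bullet> (?B *v ?u) + shift P i * (norm ?u)\<^sup>2"
    by (simp add: matrix_vector_mult_add_rdistrib scaleR_matrix_vector_assoc[symmetric]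
        inner_add_right dot_square_norm)
  have 3: "(grad Q (pt s) + hess s *v vert s) \<bullet> h_step P Q s i = ?g \<bullet> ?u"
    unfolding red_grad_def h_step_def by (rule matrix_vector_mul_dot_transpose[symmetric])
  have 4: "h_step P Q s i \<bullet> (hess s *v h_step P Q s i) = ?u \<bullet> (?B *v ?u)"
    unfolding red_hess_def h_step_def matrix_vector_mul_assoc[symmetric]
    using matrix_vector_mul_dot_transpose[of "nullb s" "hess s *v (nullb s *v ?u)" ?u]
    by (simp add: inner_commute del: transpose_matrix_vector)
  have "0 \<le> shift P i * (norm ?u)\<^sup>2"
    using shift_pos[of P i] by simp
  then show ?thesis
    using assms unfolding dq_H_def 1 2 3 4 by simp
qed

section \<open>The penalty parameter and the decrease of the merit function\<close>

lemma penalty_ge: "mu_prev s \<le> penalty P Q s i"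
proof -
  have "mu_prev s \<le> Max {m, tau1 P * mu_prev s, mu_prev s + tau2 P}" for m
    using params by (intro order_trans[OF _ Max_ge[of _ "mu_prev s + tau2 P"]]) simp_all
  then show ?thesis
    by (simp add: penalty_def Let_def)
qed

lemma penalty_pos: "0 < penalty P Q s i"
  using penalty_ge mu_prev_pos by (rule less_le_trans[rotated])

text \<open>Both branches of the update yield a penalty of at least \<open>?mc\<close>; clearing the
  positive denominator gives the bound.\<close>

lemma penalty_model_decrease:
  assumes "dq_N Q s \<noteq> 0"
  shows "nu P * penalty P Q s i * dq_N Q s \<le>
    model Q (pt s) (hess s) (penalty P Q s i) 0
    - model Q (pt s) (hess s) (penalty P Q s i) (d_step P Q s i)"
proof -
  define D where "D = dq_F Q s + dq_H Q s (h_step P Q s i)"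
  let ?mc = "- D / ((1 - nu P) * dq_N Q s)"
  have pos: "0 < (1 - nu P) * dq_N Q s"
    using assms dq_N_nonneg params by simp
  have "?mc \<le> Max {?mc, tau1 P * mu_prev s, mu_prev s + tau2 P}"
    by simp
  then have "?mc \<le> penalty P Q s i"
    using assms by (auto simp: penalty_def Let_def D_def not_less)
  then have "- D \<le> penalty P Q s i * ((1 - nu P) * dq_N Q s)"
    using pos by (simp only: pos_divide_le_eq)
  then show ?thesis
    unfolding model_decrease D_def by (simp add: algebra_simps)
qed

lemma accepted_merit_decrease:
  assumes "0 \<le> u_step P Q s i \<bullet> ((red_hess s + shift P i *\<^sub>R mat 1) *v u_step P Q s i)"
    and accept: "eta1 P \<le> ratio P Q s i"
  defines "\<mu> \<equiv> penalty P Q s i"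
  shows "eta1 P * (nu P * \<mu> * dq_N Q s) \<le> merit Q (pt s) \<mu> - merit Q (pt s + d_step P Q s i) \<mu>"
proof -
  define D where "D = model Q (pt s) (hess s) \<mu> 0 - model Q (pt s) (hess s) \<mu> (d_step P Q s i)"
  have le: "nu P * \<mu> * dq_N Q s \<le> D"
  proof (cases "dq_N Q s = 0")
    case True
    then show ?thesis
      using dq_H_nonneg[OF assms(1)] vert_eq_0[OF True]
      by (simp add: D_def model_decrease dq_F_def)
  next
    case False
    then show ?thesis
      using penalty_model_decrease unfolding D_def \<mu>_def by blast
  qed
  have "0 \<le> nu P * \<mu> * dq_N Q s"
    using dq_N_nonneg params penalty_pos[of i] by (simp add: \<mu>_def)
  \<comment> \<open>A zero denominator would make the ratio 0, and the trial would be
    rejected.\<close>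
  moreover have "D \<noteq> 0"
    using accept params by (auto simp: ratio_def Let_def D_def \<mu>_def)
  ultimately have "0 < D"
    using le by simp
  then have "eta1 P * D \<le> merit Q (pt s) \<mu> - merit Q (pt s + d_step P Q s i) \<mu>"
    using accept by (simp add: ratio_def Let_def D_def \<mu>_def pos_le_divide_eq)
  moreover have "eta1 P * (nu P * \<mu> * dq_N Q s) \<le> eta1 P * D"
    using le params by simp
  ultimately show ?thesis by simp
qed

text \<open>The model error is at most of order \<open>\<omega> sqrt \<beta>\<^sub>k\<close>, whereas away from feasibility the
  predicted decrease is at least of order \<open>sqrt \<beta>\<^sub>k\<close>.\<close>

lemma ratio_gt_eta2:
  fixes i :: nat
  defines "x \<equiv> pt s" and "d \<equiv> d_step P Q s i"
  assumes obj_error: "\<bar>obj Q (x + d) - obj Q x - grad Q x \<bullet> d\<bar> \<le> \<omega> * norm d"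
    and con_error: "norm (con Q (x + d) - con Q x - jac Q x *v d) \<le> \<omega> * norm d"
    and hess_bound: "onorm ((*v) (hess s)) \<le> \<kappa>B" and "0 \<le> \<omega>" "0 \<le> \<kappa>B"
    and d_bound: "norm d \<le> D * sqrt (reg s)" and "0 \<le> D"
    and dq_N_bound: "c * sqrt (reg s) \<le> dq_N Q s" and "0 < c"
    and m: "m \<le> mu_prev s" "0 < m"
    and small: "D * (\<omega> * (1 / m + 1) + \<kappa>B * D * sqrt (reg s) / (2 * m)) < (1 - eta2 P) * nu P * c"
  shows "eta2 P < ratio P Q s i"
proof -
  define \<mu> where "\<mu> = penalty P Q s i"
  define num where "num = merit Q x \<mu> - merit Q (x + d) \<mu>"
  define den where "den = model Q x (hess s) \<mu> 0 - model Q x (hess s) \<mu> d"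
  define r where "r = sqrt (reg s)"
  have "0 < r"
    using reg_pos by (simp add: r_def)
  have \<mu>: "0 < \<mu>" "m \<le> \<mu>"
    using penalty_pos[of i] penalty_ge[of i] m by (simp_all add: \<mu>_def)
  have "0 < dq_N Q s"
    using dq_N_bound \<open>0 < c\<close> \<open>0 < r\<close> less_le_trans[OF mult_pos_pos[OF \<open>0 < c\<close> \<open>0 < r\<close>]]
    by (simp add: r_def)
  then have den_ge: "nu P * \<mu> * dq_N Q s \<le> den"
    using penalty_model_decrease[of i] by (simp add: den_def \<mu>_def x_def d_def)
  then have "0 < den"
    using \<open>0 < dq_N Q s\<close> \<mu> params by (intro less_le_trans[OF _ den_ge]) simp
  have "d \<bullet> (hess s *v d) \<ge> - (\<kappa>B * (norm d)\<^sup>2)"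
  proof -
    have "\<bar>d \<bullet> (hess s *v d)\<bar> \<le> norm d * norm (hess s *v d)"
      by (rule Cauchy_Schwarz_ineq2)
    also have "\<dots> \<le> norm d * (\<kappa>B * norm d)"
      by (intro mult_left_mono norm_matrix_vector_le hess_bound) simp
    finally show ?thesis
      by (simp add: power2_eq_square mult_ac)
  qed
  moreover have "norm (con Q (x + d)) \<le> norm (con Q x + jac Q x *v d) + \<omega> * norm d"
    using norm_triangle_ineq[of "con Q x + jac Q x *v d" "con Q (x + d) - con Q x - jac Q x *v d"]
      con_error by simp
  then have "\<mu> * norm (con Q (x + d)) \<le> \<mu> * (norm (con Q x + jac Q x *v d) + \<omega> * norm d)"
    using \<mu> by simp
  ultimately have "den - num \<le> \<omega> * norm d + \<kappa>B * (norm d)\<^sup>2 / 2 + \<mu> * (\<omega> * norm d)"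
    using obj_error unfolding num_def den_def merit_def model_def by (simp add: algebra_simps)
  also have "\<dots> \<le> \<omega> * (D * r) + \<kappa>B * (D * r)\<^sup>2 / 2 + \<mu> * (\<omega> * (D * r))"
    using d_bound \<mu> \<open>0 \<le> \<omega>\<close> \<open>0 \<le> \<kappa>B\<close> unfolding r_def
    by (intro add_mono mult_left_mono divide_right_mono power_mono) simp_all
  also have "\<dots> = r * (D * (\<omega> + \<omega> * \<mu> + \<kappa>B * D * r / 2))"
    by (simp add: power2_eq_square algebra_simps)
  \<comment> \<open>Since \<open>1 \<le> \<mu> / m\<close>, the penalty can be made a common factor;
    the smallness condition then involves only \<open>m\<close> and is uniform in an unbounded
    penalty.\<close>
  also have "\<dots> \<le> r * (D * (\<mu> * (\<omega> * (1 / m + 1) + \<kappa>B * D * r / (2 * m))))"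
  proof -
    have "1 \<le> \<mu> / m"
      using \<mu> m by simp
    then have "\<omega> * 1 \<le> \<omega> * (\<mu> / m)" "(\<kappa>B * D * r / 2) * 1 \<le> (\<kappa>B * D * r / 2) * (\<mu> / m)"
      using \<open>0 \<le> \<omega>\<close> \<open>0 \<le> \<kappa>B\<close> \<open>0 \<le> D\<close> \<open>0 < r\<close> by (intro mult_left_mono; simp)+
    then have "\<omega> + \<omega> * \<mu> + \<kappa>B * D * r / 2 \<le> \<mu> * (\<omega> * (1 / m + 1) + \<kappa>B * D * r / (2 * m))"
      by (simp add: algebra_simps)
    then show ?thesis
      using \<open>0 \<le> D\<close> \<open>0 < r\<close> by (simp add: mult_left_mono)
  qed
  also have "\<dots> = (r * \<mu>) * (D * (\<omega> * (1 / m + 1) + \<kappa>B * D * r / (2 * m)))"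
    by simp
  also have "\<dots> < (r * \<mu>) * ((1 - eta2 P) * nu P * c)"
    using small \<mu> \<open>0 < r\<close> unfolding r_def by (intro mult_strict_left_mono) simp_all
  also have "\<dots> = (1 - eta2 P) * (nu P * \<mu> * (c * r))"
    by simp
  also have "\<dots> \<le> (1 - eta2 P) * (nu P * \<mu> * dq_N Q s)"
    using dq_N_bound \<mu> params unfolding r_def by (intro mult_left_mono) simp_all
  also have "\<dots> \<le> (1 - eta2 P) * den"
    using den_ge params by (intro mult_left_mono) simp_all
  finally have "eta2 P * den < num"
    by (simp add: algebra_simps)
  then have "eta2 P < num / den"
    using \<open>0 < den\<close> by (simp add: pos_less_divide_eq)
  then show ?thesis
    by (simp add: ratio_def Let_def num_def den_def \<mu>_def x_def d_def)
qed

end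

subsection \<open>The infinite run\<close>

locale infinite_run =
  fixes carry :: bool and P :: ssarc_params and Q :: "('n::finite, 'p::finite) nlp"
    and S :: "nat \<Rightarrow> ('n, 'z::finite) ssarc_state" and j :: "nat \<Rightarrow> nat" and b :: "nat \<Rightarrow> real"
    and t \<beta>max \<kappa>B \<kappa>n L :: real
  assumes smooth: "smooth_nlp Q" and valid: "valid_params P" and t: "1 \<le> t"
    and run: "ssarc_run carry P Q S j b"
    and rank: "\<And>k. rank (jac Q (pt (S k))) = CARD('p)"
    and adequate: "\<And>k. adequate_pair P t Q (S k) (b k) (shift P (j k)) (u_step P Q (S k) (j k))"
    and reg_le: "\<And>k. reg (S k) \<le> \<beta>max"
    and obj_bdd: "bdd_below (range (obj Q))"
    and con_lipschitz:
      "\<And>k l. norm (con Q (pt (S k)) - con Q (pt (S l))) \<le> L * norm (pt (S k) - pt (S l))"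
    and hess_bound: "0 \<le> \<kappa>B" "\<And>k. onorm ((*v) (hess (S k))) \<le> \<kappa>B"
    and cauchy_vert_bound: "0 < \<kappa>n"
      "\<And>k. norm (cauchy_vert Q (pt (S k))) \<le> \<kappa>n * norm (con Q (pt (S k)))"
begin

section \<open>Positivity along the run and lengths of accepted steps\<close>

lemma iteration: "ssarc_iteration carry P Q (S k) (j k) (b k) (S (Suc k))"
  using run by (simp add: ssarc_run_def)

lemma outer: "outer_iteration P Q (S k)"
proof (induction k)
  case 0
  then show ?case
    using run iteration[of 0] valid rank[of 0]
    by (simp add: outer_iteration_def ssarc_run_def ssarc_iteration_def)
next
  case (Suc k)
  interpret outer_iteration P Q "S k" by fact
  \<comment> \<open>For \<open>b k = 0\<close> the quotient in \<open>adequate_pair\<close> is 0,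
    and its upper bound would make the shift nonpositive.\<close>
  have "b k \<noteq> 0"
    using adequate[of k] shift_pos[of P "j k"] by (auto simp: adequate_pair_def Let_def)
  then have "0 < b k"
    using trial_bounds(2) iteration[of k] by (force simp: ssarc_iteration_def)
  then have "0 < reg (S (Suc k))" "0 < mu_prev (S (Suc k))"
    using iteration[of k] params penalty_pos by (auto simp: ssarc_iteration_def)
  then show ?case
    using iteration[of "Suc k"] valid rank[of "Suc k"]
    by (simp add: outer_iteration_def ssarc_iteration_def)
qed

sublocale outer: outer_iteration P Q "S k" for k
  by (rule outer)

text \<open>There are finitely many shifts, so the upper bound on the step by \<open>t\<close> times
  shift times \<open>b k\<close> is of order \<open>reg (S k)\<close>.\<close>

lemma norm_u_step_le: "norm (u_step P Q (S k) (j k)) \<le> t * shift P (last_shift P) * reg (S k)"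
proof -
  have tr: "trial carry P Q (S k) (j k) (b k)"
    using iteration[of k] by (simp add: ssarc_iteration_def)
  note bounds = outer.trial_bounds[OF tr]
  have "b k \<noteq> 0"
    using adequate[of k] shift_pos[of P "j k"] by (auto simp: adequate_pair_def Let_def)
  then have "0 < b k"
    using bounds by simp
  moreover have "1 / t * (norm (u_step P Q (S k) (j k)) / b k) \<le> shift P (j k)"
    using adequate[of k] by (simp add: adequate_pair_def Let_def)
  ultimately have "norm (u_step P Q (S k) (j k)) \<le> t * shift P (j k) * b k"
    using t by (simp add: field_simps)
  also have "\<dots> \<le> t * shift P (last_shift P) * reg (S k)"
    using bounds t shift_mono[OF bounds(1)] shift_pos[of P "j k"] shift_pos[of P "last_shift P"]
    by (intro mult_mono) simp_all
  finally show ?thesis .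
qed

lemma mu_prev_mono: "mu_prev (S 0) \<le> mu_prev (S k)"
proof (rule lift_Suc_mono_le[of "\<lambda>k. mu_prev (S k)" 0 k])
  fix k
  have "mu_prev (S (Suc k)) = penalty P Q (S k) (j k)"
    using iteration[of k] by (simp add: ssarc_iteration_def)
  then show "mu_prev (S k) \<le> mu_prev (S (Suc k))"
    using outer.penalty_ge by simp
qed simp

text \<open>Since \<open>\<mu>\<^sub>k\<close> is nondecreasing and \<open>f\<close> exceeds its infimum, \<open>(f(x\<^sub>k) - inf f) / \<mu>\<^sub>k\<^sub>-\<^sub>1 + \<parallel>c\<^sub>k\<parallel>\<close>
  decreases by a multiple of the predicted decrease of infeasibility, whatever the behaviour
  of the penalty parameter.\<close>

lemma summable_dq_N: "summable (\<lambda>k. dq_N Q (S k))"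
proof -
  obtain fl where fl: "\<And>y. fl \<le> obj Q y"
    using obj_bdd by (auto simp: bdd_below_def)
  define E where "E k = (obj Q (pt (S k)) - fl) / mu_prev (S k) + norm (con Q (pt (S k)))" for k
  define e where "e = eta1 P * nu P"
  have "0 < e"
    using outer.params by (simp add: e_def)
  have step: "E (Suc k) \<le> E k - e * dq_N Q (S k)" for k
  proof -
    define \<mu> where "\<mu> = penalty P Q (S k) (j k)"
    have next': "mu_prev (S (Suc k)) = \<mu>" "pt (S (Suc k)) = pt (S k) + d_step P Q (S k) (j k)"
      and accept: "eta1 P \<le> ratio P Q (S k) (j k)"
      using iteration[of k] by (simp_all add: ssarc_iteration_def \<mu>_def)
    have \<mu>: "0 < \<mu>" "mu_prev (S k) \<le> \<mu>"
      using outer.penalty_pos outer.penalty_ge by (simp_all add: \<mu>_def)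
    have "eta1 P * (nu P * \<mu> * dq_N Q (S k)) \<le>
        merit Q (pt (S k)) \<mu> - merit Q (pt (S k) + d_step P Q (S k) (j k)) \<mu>"
      using outer.accepted_merit_decrease[of k "j k"] adequate[of k] accept
      by (simp add: \<mu>_def adequate_pair_def Let_def)
    then have "\<mu> * (e * dq_N Q (S k)) \<le>
        (obj Q (pt (S k)) - fl + \<mu> * norm (con Q (pt (S k))))
        - (obj Q (pt (S (Suc k))) - fl + \<mu> * norm (con Q (pt (S (Suc k)))))"
      by (simp add: merit_def e_def next' algebra_simps)
    also have "\<dots> = \<mu> * (((obj Q (pt (S k)) - fl) / \<mu> + norm (con Q (pt (S k)))) - E (Suc k))"
      using \<mu> by (simp add: E_def next'(1) right_diff_distrib distrib_left diff_divide_distrib)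
    finally have "e * dq_N Q (S k) \<le>
        ((obj Q (pt (S k)) - fl) / \<mu> + norm (con Q (pt (S k)))) - E (Suc k)"
      using \<mu> by (simp only: mult_le_cancel_left_pos)
    \<comment> \<open>Subtracting \<open>fl\<close> makes the numerator nonnegative, so the smaller
      previous penalty only enlarges the quotient.\<close>
    moreover have "(obj Q (pt (S k)) - fl) / \<mu> \<le> (obj Q (pt (S k)) - fl) / mu_prev (S k)"
      using \<mu> outer.mu_prev_pos[of k] fl by (intro divide_left_mono) simp_all
    ultimately show ?thesis
      by (simp add: E_def)
  qed
  have "(\<Sum>i<n. e * dq_N Q (S i)) \<le> E 0 - E n" for n
  proof (induction n)
    case (Suc n)
    then show ?case
      using step[of n] by simp
  qed simp
  moreover have "0 \<le> E n" for n
    using outer.mu_prev_pos[of n] fl by (simp add: E_def)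
  ultimately have "(\<Sum>i<n. e * dq_N Q (S i)) \<le> E 0" for n
    by (smt (verit))
  then have "summable (\<lambda>k. e * dq_N Q (S k))"
    using outer.dq_N_nonneg \<open>0 < e\<close> by (intro summableI_nonneg_bounded) simp_all
  then show ?thesis
    using \<open>0 < e\<close> by (simp add: summable_cmult_iff)
qed

text \<open>In the factor \<open>2 + t\<close>, the summand \<open>t\<close> serves accepted trials and \<open>2\<close> rejected
  first trials.\<close>

definition step_const :: real where
  "step_const = 1 + (2 + t) * shift P (last_shift P) * sqrt \<beta>max"

lemma step_const_pos: "0 < step_const"
proof -
  have "0 \<le> \<beta>max"
    using outer.reg_pos[of 0] reg_le[of 0] by simp
  then show ?thesis
    using t shift_pos[of P "last_shift P"] unfolding step_const_def
    by (intro add_pos_nonneg mult_nonneg_nonneg) simp_all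
qed

text \<open>The bound on \<open>reg\<close> absorbs one factor \<open>sqrt (reg (S k))\<close> of
  the horizontal step into the constant.\<close>

lemma norm_d_step_le:
  assumes "norm (u_step P Q (S k) i) \<le> (2 + t) * shift P (last_shift P) * reg (S k)"
  shows "norm (d_step P Q (S k) i) \<le> step_const * sqrt (reg (S k))"
proof -
  have "reg (S k) = sqrt (reg (S k)) * sqrt (reg (S k))"
    using outer.reg_pos[of k] by simp
  also have "\<dots> \<le> sqrt \<beta>max * sqrt (reg (S k))"
    using reg_le[of k] outer.reg_pos[of k] by (intro mult_right_mono) simp_all
  finally have "(2 + t) * shift P (last_shift P) * reg (S k) \<le>
      (2 + t) * shift P (last_shift P) * (sqrt \<beta>max * sqrt (reg (S k)))"
    using t shift_pos[of P "last_shift P"] by (intro mult_left_mono) simp_all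
  then show ?thesis
    using assms outer.norm_d_step_le[of k i] by (simp add: step_const_def algebra_simps)
qed

lemma accepted_step:
  "norm (pt (S (Suc k)) - pt (S k)) \<le> step_const * sqrt (reg (S k))"
proof -
  have "t * shift P (last_shift P) * reg (S k) \<le> (2 + t) * shift P (last_shift P) * reg (S k)"
    using shift_pos[of P "last_shift P"] outer.reg_pos[of k] by (simp add: algebra_simps)
  then have "norm (d_step P Q (S k) (j k)) \<le> step_const * sqrt (reg (S k))"
    using norm_u_step_le[of k] by (intro norm_d_step_le) simp
  then show ?thesis
    using iteration[of k] by (simp add: ssarc_iteration_def)
qed

lemma sqrt_reg_le:
  assumes "dq_N Q (S k) < norm (con Q (pt (S k)))"
  shows "theta P / \<kappa>n * sqrt (reg (S k)) \<le> dq_N Q (S k)"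
  using outer.dq_N_ge[OF cauchy_vert_bound(2,1), of k] assms by (simp add: min_def split: if_splits)

text \<open>An excursion of \<open>\<parallel>c\<^sub>k\<parallel>\<close> from above \<open>2 \<epsilon>\<close> to below \<open>\<epsilon>\<close> is impossible for large \<open>k\<close>: as long as
  \<open>\<parallel>c\<^sub>k\<parallel> \<ge> \<epsilon>\<close>, the steps are bounded by the terms of a convergent series.\<close>

lemma dq_N_less_norm_con:
  assumes "\<not> (\<lambda>k. con Q (pt (S k))) \<longlonglongrightarrow> 0"
  obtains K where "\<And>k. K \<le> k \<Longrightarrow> dq_N Q (S k) < norm (con Q (pt (S k)))"
proof -
  let ?c = "\<lambda>k. con Q (pt (S k))"
  obtain e where "0 < e" and inf: "\<And>K. \<exists>k\<ge>K. e \<le> norm (?c k)"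
    using assms unfolding LIMSEQ_iff by (auto simp: not_less)
  define \<epsilon> where "\<epsilon> = e / 2"
  \<comment> \<open>While the normal decrease is below the infeasibility, \<open>M\<close> times it
    bounds the step length.\<close>
  define M where "M = step_const * \<kappa>n / theta P"
  have "0 < \<epsilon>" "0 < M"
    using \<open>0 < e\<close> step_const_pos cauchy_vert_bound outer.params by (simp_all add: \<epsilon>_def M_def)
  have "(\<lambda>k. dq_N Q (S k)) \<longlonglongrightarrow> 0"
    by (rule summable_LIMSEQ_zero[OF summable_dq_N])
  then obtain K1 where K1: "\<And>k. K1 \<le> k \<Longrightarrow> dq_N Q (S k) < \<epsilon>"
    using \<open>0 < \<epsilon>\<close> unfolding LIMSEQ_iff by fastforce
  \<comment> \<open>Movement by at most \<open>M * a\<close> changes the constraint value by at most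
    \<epsilon>; the added 1 keeps the denominator positive.\<close>
  define a where "a = \<epsilon> / (M * (\<bar>L\<bar> + 1))"
  have "0 < a"
    using \<open>0 < \<epsilon>\<close> \<open>0 < M\<close> by (simp add: a_def)
  then obtain K2 where K2: "\<And>m n. K2 \<le> m \<Longrightarrow> norm (\<Sum>i\<in>{m..<n}. dq_N Q (S i)) < a"
    using summable_dq_N unfolding summable_Cauchy by blast
  obtain K where K: "K1 \<le> K" "K2 \<le> K" "e \<le> norm (?c K)"
    using inf[of "max K1 K2"] by auto
  have close: "\<epsilon> \<le> norm (?c k)"
    if "norm (pt (S k) - pt (S K)) \<le> M * (\<Sum>i\<in>{K..<k}. dq_N Q (S i))" for k
  proof -
    have "norm (?c k - ?c K) \<le> L * norm (pt (S k) - pt (S K))"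
      by (rule con_lipschitz)
    also have "\<dots> \<le> (\<bar>L\<bar> + 1) * norm (pt (S k) - pt (S K))"
      by (intro mult_right_mono) simp_all
    also have "\<dots> \<le> (\<bar>L\<bar> + 1) * (M * a)"
    proof (intro mult_left_mono order_trans[OF that])
      show "(\<Sum>i\<in>{K..<k}. dq_N Q (S i)) \<le> a"
        using K2[OF K(2), of k] by simp
    qed (use \<open>0 < M\<close> in simp_all)
    also have "\<dots> = \<epsilon>"
      using \<open>0 < M\<close> by (simp add: a_def)
    finally show ?thesis
      using K(3) norm_triangle_ineq2[of "?c K" "?c k"] by (simp add: \<epsilon>_def norm_minus_commute)
  qed
  \<comment> \<open>The distance bound at \<open>k\<close> gives, by \<open>close\<close>, an
    infeasibility of at least \<epsilon>, above the normal decrease; this bounds the next step and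
    so the next distance.\<close>
  have path: "norm (pt (S k) - pt (S K)) \<le> M * (\<Sum>i\<in>{K..<k}. dq_N Q (S i))" if "K \<le> k" for k
    using that
  proof (induction rule: dec_induct)
    case base
    then show ?case by simp
  next
    case (step k)
    have "dq_N Q (S k) < norm (?c k)"
      using close[OF step.IH] K1[of k] K step.hyps by simp
    then have "sqrt (reg (S k)) \<le> \<kappa>n / theta P * dq_N Q (S k)"
      using sqrt_reg_le[of k] cauchy_vert_bound outer.params by (simp add: field_simps)
    then have "step_const * sqrt (reg (S k)) \<le> M * dq_N Q (S k)"
      using step_const_pos mult_left_mono[of "sqrt (reg (S k))" "\<kappa>n / theta P * dq_N Q (S k)" step_const]
      by (simp add: M_def)
    then have "norm (pt (S (Suc k)) - pt (S k)) \<le> M * dq_N Q (S k)"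
      using accepted_step[of k] by simp
    then have "norm ((pt (S (Suc k)) - pt (S k)) + (pt (S k) - pt (S K)))
        \<le> M * dq_N Q (S k) + M * (\<Sum>i\<in>{K..<k}. dq_N Q (S i))"
      using step.IH by (rule norm_triangle_mono)
    then show ?case
      using step.hyps by (simp add: algebra_simps)
  qed
  show thesis
  proof (rule that)
    fix k assume "K \<le> k"
    then show "dq_N Q (S k) < norm (?c k)"
      using close[OF path] K1[of k] K by fastforce
  qed
qed

text \<open>All indices with a short step are covered, so that the conclusion applies to a rejected
  first trial as well as to the accepted one.\<close>

lemma eventually_very_successful:
  assumes x: "(\<lambda>k. pt (S k)) \<longlonglongrightarrow> z" and reg: "(\<lambda>k. reg (S k)) \<longlonglongrightarrow> 0"
    and "0 < c" and dq: "\<forall>\<^sub>F k in sequentially. c * sqrt (reg (S k)) \<le> dq_N Q (S k)"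
  shows "\<forall>\<^sub>F k in sequentially. \<forall>i.
    norm (u_step P Q (S k) i) \<le> (2 + t) * shift P (last_shift P) * reg (S k)
    \<longrightarrow> eta2 P < ratio P Q (S k) i"
proof -
  define m where "m = mu_prev (S 0)"
  define D where "D = step_const"
  define g where "g = (1 - eta2 P) * nu P * c"
  \<comment> \<open>Half of the margin \<open>g\<close> goes to the linearization errors; the
    curvature term gets the other half, as it vanishes with \<open>reg\<close>.\<close>
  define \<omega> where "\<omega> = g / (2 * D * (1 / m + 1))"
  have pos: "0 < m" "0 < D" "0 < g"
    using outer.mu_prev_pos[of 0] step_const_pos outer.params \<open>0 < c\<close>
    by (simp_all add: m_def D_def g_def)
  have "0 < 1 / m + 1"
    using pos by (simp add: add_pos_pos)
  then have \<omega>: "0 < \<omega>" "D * (\<omega> * (1 / m + 1)) = g / 2"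
    using pos by (simp_all add: \<omega>_def)
  obtain r1 where "0 < r1" and r1: "\<And>x y. x \<in> ball z r1 \<Longrightarrow> y \<in> ball z r1 \<Longrightarrow>
       norm (obj Q y - obj Q x - grad Q x \<bullet> (y - x)) \<le> \<omega> * norm (y - x)"
  proof (rule strict_differentiability[of inner "obj Q" "grad Q" \<omega> z])
    show "(obj Q has_derivative inner (grad Q x)) (at x)" for x
    proof -
      have "inner (grad Q x) = (\<lambda>h. h \<bullet> grad Q x)"
        by (simp add: inner_commute fun_eq_iff)
      then show ?thesis
        using smooth by (simp add: smooth_nlp_def gderiv_def)
    qed
  qed (use smooth \<omega> bounded_bilinear_inner in \<open>auto simp: smooth_nlp_def\<close>)
  obtain r2 where "0 < r2" and r2: "\<And>x y. x \<in> ball z r2 \<Longrightarrow> y \<in> ball z r2 \<Longrightarrow>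
       norm (con Q y - con Q x - jac Q x *v (y - x)) \<le> \<omega> * norm (y - x)"
    by (rule strict_differentiability[of "(*v)" "con Q" "jac Q" \<omega> z])
      (use smooth \<omega> bounded_bilinear_matrix_vector_mult in \<open>auto simp: smooth_nlp_def\<close>)
  define r where "r = min r1 r2"
  have "0 < r"
    using \<open>0 < r1\<close> \<open>0 < r2\<close> by (simp add: r_def)
  have sqrt_reg: "(\<lambda>k. sqrt (reg (S k))) \<longlonglongrightarrow> 0"
    using tendsto_real_sqrt[OF reg] by simp
  have "\<forall>\<^sub>F k in sequentially. dist (pt (S k)) z < r / 2"
    using \<open>0 < r\<close> by (intro tendstoD[OF x]) simp
  moreover have "\<forall>\<^sub>F k in sequentially. D * sqrt (reg (S k)) < r / 2"
    using \<open>0 < r\<close> by (intro order_tendstoD(2)[OF tendsto_mult_right_zero[OF sqrt_reg]]) simp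
  moreover have "\<forall>\<^sub>F k in sequentially. D * \<kappa>B * D / (2 * m) * sqrt (reg (S k)) < g / 2"
    using pos by (intro order_tendstoD(2)[OF tendsto_mult_right_zero[OF sqrt_reg]]) simp
  ultimately show ?thesis
    using dq
  proof eventually_elim
    case (elim k)
    show ?case
    proof (intro allI impI)
      fix i
      let ?x = "pt (S k)" and ?d = "d_step P Q (S k) i"
      assume "norm (u_step P Q (S k) i) \<le> (2 + t) * shift P (last_shift P) * reg (S k)"
      then have d: "norm ?d \<le> D * sqrt (reg (S k))"
        unfolding D_def by (rule norm_d_step_le)
      have "dist (?x + ?d) z \<le> norm ?d + dist ?x z"
        using dist_triangle[of "?x + ?d" z ?x] by (simp add: dist_norm)
      then have "?x \<in> ball z r" "?x + ?d \<in> ball z r"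
        using d elim \<open>0 < r\<close> by (simp_all add: dist_commute)
      then have ball: "?x \<in> ball z r1" "?x + ?d \<in> ball z r1" "?x \<in> ball z r2" "?x + ?d \<in> ball z r2"
        by (simp_all add: r_def)
      show "eta2 P < ratio P Q (S k) i"
      proof (rule outer.ratio_gt_eta2[of k i \<omega> \<kappa>B D c m])
        show "\<bar>obj Q (?x + ?d) - obj Q ?x - grad Q ?x \<bullet> ?d\<bar> \<le> \<omega> * norm ?d"
          using r1[OF ball(1,2)] by simp
        show "norm (con Q (?x + ?d) - con Q ?x - jac Q ?x *v ?d) \<le> \<omega> * norm ?d"
          using r2[OF ball(3,4)] by simp
        have "D * (\<omega> * (1 / m + 1) + \<kappa>B * D * sqrt (reg (S k)) / (2 * m))
            = D * (\<omega> * (1 / m + 1)) + D * \<kappa>B * D / (2 * m) * sqrt (reg (S k))"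
          by (simp add: distrib_left)
        then show "D * (\<omega> * (1 / m + 1) + \<kappa>B * D * sqrt (reg (S k)) / (2 * m))
            < (1 - eta2 P) * nu P * c"
          using elim \<omega>(2) unfolding g_def by simp
      qed (use hess_bound \<omega> d pos elim \<open>0 < c\<close> mu_prev_mono in \<open>simp_all add: m_def\<close>)
    qed
  qed
qed

lemma con_tendsto_0: "(\<lambda>k. con Q (pt (S k))) \<longlonglongrightarrow> 0"
proof (rule ccontr)
  assume "\<not> ?thesis"
  then obtain K where K: "\<And>k. K \<le> k \<Longrightarrow> dq_N Q (S k) < norm (con Q (pt (S k)))"
    using dq_N_less_norm_con by metis
  define c where "c = theta P / \<kappa>n"
  have "0 < c"
    using cauchy_vert_bound outer.params by (simp add: c_def)
  have dq: "c * sqrt (reg (S k)) \<le> dq_N Q (S k)" if "K \<le> k" for k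
    unfolding c_def using K[OF that] by (rule sqrt_reg_le)
  then have sqrt_reg: "sqrt (reg (S k)) \<le> dq_N Q (S k) / c" if "K \<le> k" for k
    using that \<open>0 < c\<close> by (simp add: field_simps)
  have "summable (\<lambda>k. pt (S (Suc k)) - pt (S k))"
  proof (rule summable_comparison_test)
    show "summable (\<lambda>k. step_const * (dq_N Q (S k) / c))"
      using summable_dq_N by (intro summable_mult summable_divide)
    show "\<exists>N. \<forall>k\<ge>N. norm (pt (S (Suc k)) - pt (S k)) \<le> step_const * (dq_N Q (S k) / c)"
    proof (intro exI allI impI)
      fix k assume "K \<le> k"
      show "norm (pt (S (Suc k)) - pt (S k)) \<le> step_const * (dq_N Q (S k) / c)"
        using step_const_pos
        by (intro order_trans[OF accepted_step] mult_left_mono sqrt_reg \<open>K \<le> k\<close>) simp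
    qed
  qed
  \<comment> \<open>Summable increments telescope to a convergent sequence of iterates.\<close>
  from tendsto_add[OF summable_LIMSEQ[OF this] tendsto_const, of "pt (S 0)"]
  obtain z where z: "(\<lambda>k. pt (S k)) \<longlonglongrightarrow> z"
    by (auto simp: sum_lessThan_telescope[of "\<lambda>k. pt (S k)"])
  have "(\<lambda>k. sqrt (reg (S k))) \<longlonglongrightarrow> 0"
  proof (rule tendsto_sandwich[OF _ _ tendsto_const])
    show "(\<lambda>k. dq_N Q (S k) / c) \<longlonglongrightarrow> 0"
      by (rule tendsto_divide_zero[OF summable_LIMSEQ_zero[OF summable_dq_N]])
    show "\<forall>\<^sub>F k in sequentially. sqrt (reg (S k)) \<le> dq_N Q (S k) / c"
      using sqrt_reg eventually_sequentially by blast
    show "\<forall>\<^sub>F k in sequentially. 0 \<le> sqrt (reg (S k))"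
      using outer.reg_pos by (simp add: less_imp_le)
  qed
  from tendsto_power[OF this, of 2] have reg: "(\<lambda>k. reg (S k)) \<longlonglongrightarrow> 0"
    using outer.reg_pos by (simp add: less_imp_le)
  have "\<forall>\<^sub>F k in sequentially. c * sqrt (reg (S k)) \<le> dq_N Q (S k)"
    using dq eventually_sequentially by blast
  then obtain N where N: "\<And>k i. N \<le> k \<Longrightarrow>
      norm (u_step P Q (S k) i) \<le> (2 + t) * shift P (last_shift P) * reg (S k) \<Longrightarrow>
      eta2 P < ratio P Q (S k) i"
    using eventually_very_successful[OF z reg \<open>0 < c\<close>] unfolding eventually_sequentially by blast
  \<comment> \<open>A rejected short step would have ratio below \<open>eta1 P\<close> yet above
    \<open>eta2 P\<close>. So \<open>b k\<close> is still \<open>reg (S k)\<close>, and the very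
    successful accepted trial multiplies it by \<open>gamma2 P\<close>.\<close>
  have grow: "reg (S k) \<le> reg (S (Suc k))" if "N \<le> k" for k
  proof -
    let ?l = "shift P (last_shift P) * reg (S k)"
    have "0 < ?l"
      using shift_pos outer.reg_pos by simp
    then have l: "t * ?l \<le> (2 + t) * ?l" "2 * ?l \<le> (2 + t) * ?l"
      using t by (simp_all add: mult_right_mono)
    have "trial carry P Q (S k) (j k) (b k)"
      using iteration[of k] by (simp add: ssarc_iteration_def)
    then have "b k = reg (S k)"
    proof (rule outer.trial_reg_or_rejected[THEN disjE])
      assume "\<exists>i. norm (u_step P Q (S k) i) \<le> 2 * shift P (last_shift P) * reg (S k)
        \<and> ratio P Q (S k) i < eta1 P"
      then obtain i where i: "norm (u_step P Q (S k) i) \<le> 2 * ?l" "ratio P Q (S k) i < eta1 P"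
        by (auto simp: mult.assoc)
      have "eta2 P < ratio P Q (S k) i"
        using i l by (intro N[OF that]) (simp add: mult.assoc)
      then show ?thesis
        using i outer.params by simp
    qed
    moreover have "eta2 P < ratio P Q (S k) (j k)"
      using norm_u_step_le[of k] l by (intro N[OF that]) (simp add: mult.assoc)
    ultimately have "reg (S (Suc k)) = gamma2 P * reg (S k)"
      using iteration[of k] by (simp add: ssarc_iteration_def)
    then show ?thesis
      using outer.params outer.reg_pos[of k] by (simp add: less_imp_le)
  qed
  have "reg (S N) \<le> reg (S k)" if "N \<le> k" for k
    using that
  proof (induction rule: dec_induct)
    case (step k)
    then show ?case
      using grow[of k] by simp
  qed simp
  then have "reg (S N) \<le> 0"
    using LIMSEQ_le_const[OF reg] by blast
  then show False
    using outer.reg_pos[of N] by simp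
qed

end

theorem theorem1:
  fixes P :: ssarc_params
    and Q :: "('n::finite, 'p::finite) nlp"
    and S :: "nat \<Rightarrow> ('n, 'z::finite) ssarc_state"
    and j :: "nat \<Rightarrow> nat" and b :: "nat \<Rightarrow> real"
    and x :: "nat \<Rightarrow> real^'n"
    and carry :: bool
    and C :: "(real^'n) set"
    and t \<beta>max \<kappa>B \<kappa>n :: real
  assumes "CARD('p) \<le> CARD('n)" and "CARD('z) = max 1 (CARD('n) - CARD('p))"
    and "smooth_nlp Q" and "valid_params P" and "t \<ge> 1"
    and "ssarc_run carry P Q S j b"
    and "\<And>k. x k = pt (S k)"
    and "\<And>k. rank (jac Q (x k)) = CARD('p)"
    and "\<And>k. adequate_pair P t Q (S k) (b k) (shift P (j k)) (u_step P Q (S k) (j k))"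
    and "\<beta>max > 0" and "\<And>k. reg (S k) \<le> \<beta>max"
    and A1: "bdd_below (range (obj Q))" "bounded (range (grad Q))" "bounded (range (con Q))"
    and A2: "open C" "range x \<subseteq> C"
      "\<exists>L. L-lipschitz_on C (grad Q)" "\<exists>L. L-lipschitz_on C (con Q)"
      "\<And>i. \<exists>L. L-lipschitz_on C (\<lambda>y. jac Q y $ i)"
    and A3: "\<kappa>B \<ge> 0" "\<And>k. onorm ((*v) (hess (S k))) \<le> \<kappa>B"
    and A4: "\<kappa>n > 0" "\<And>k. norm (cauchy_vert Q (x k)) \<le> \<kappa>n * norm (con Q (x k))"
  shows "(\<lambda>k. con Q (x k)) \<longlonglongrightarrow> 0"
proof -
  obtain L where L: "L-lipschitz_on C (con Q)"
    using A2(4) by blast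
  have "norm (con Q (x k) - con Q (x l)) \<le> L * norm (x k - x l)" for k l
    using lipschitz_onD[OF L, of "x k" "x l"] A2(2) by (auto simp: dist_norm)
  then interpret infinite_run carry P Q S j b t \<beta>max \<kappa>B \<kappa>n L
    using assms by unfold_locales simp_all
  show ?thesis
    using con_tendsto_0 assms(7) by simp
qed

end
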